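(* Let $u_1,u_2\ge 1$ and $\gamma>1$. Consider the problem of steering the system $\dot x_1=x_2$, $\dot x_2=-u x_1+1/x_1^3$ (with $x_1>0$) from $(x_1(0),x_2(0))=(1,0)$ to $(x_1(T),x_2(T))=(\gamma,0)$ in minimum time $T$ by Lebesgue measurable controls $u$ with values in $[-u_1,u_2]$. Every optimal trajectory has either the one-switching form $XY$ or the spiral form $YX\ldots YXY$ with an even number of switchings (that is, it starts and ends with a $Y$-segment, $X$- and $Y$-segments alternate, and the number of switchings is $2n$ for some integer $n\ge1$).
   Context: The state space is $\mathcal D=\{(x_1,x_2)\in\mathbb R^2: x_1>0\}$. An $X$-trajectory ($X$-segment) is a trajectory (piece) corresponding to the constant control $u\equiv -u_1$; a $Y$-trajectory ($Y$-segment) is a trajectory (piece) corresponding to the constant control $u\equiv u_2$. $XY$ denotes the concatenation of an $X$-segment followed by a $Y$-segment, $YX$ the concatenation in the inverse order, and similarly for longer words. A switching is a time at which the control changes between the values $-u_1$ and $u_2$. A trajectory is optimal if it achieves the transfer $(1,0)\to(\gamma,0)$ in minimum time. *)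

theory Defs
  imports "HOL-Analysis.Analysis"
begin

definition state_space :: "(real \<times> real) set" where
  "state_space = {p. fst p > 0}"

definition vector_field :: "real \<Rightarrow> real \<times> real \<Rightarrow> real \<times> real" where
  "vector_field v p = (snd p, - v * fst p + 1 / fst p ^ 3)"

text \<open>
  Trajectories are Caratheodory solutions, stated through the integral equation because controls
  are only measurable.  For a bounded Lebesgue measurable control the integrand is bounded and
  measurable (\<open>x\<close> is continuous, hence \<open>fst \<circ> x\<close> is bounded away from \<open>0\<close>), so this says exactly
  that \<open>x\<close> is absolutely continuous on \<open>{a..b}\<close> and solves the differential equation almost
  everywhere.
\<close>
definition trajectory_on ::
    "real \<Rightarrow> real \<Rightarrow> (real \<Rightarrow> real) \<Rightarrow> (real \<Rightarrow> real \<times> real) \<Rightarrow> bool" where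
  "trajectory_on a b u x \<longleftrightarrow>
     (\<forall>t\<in>{a..b}. x t \<in> state_space \<and>
        ((\<lambda>s. vector_field (u s) (x s)) has_integral (x t - x a)) {a..t})"

definition admissible_control :: "real \<Rightarrow> real \<Rightarrow> real \<Rightarrow> (real \<Rightarrow> real) \<Rightarrow> bool" where
  "admissible_control u1 u2 T u \<longleftrightarrow>
     u \<in> borel_measurable (lebesgue_on {0..T}) \<and> (\<forall>t\<in>{0..T}. u t \<in> {- u1..u2})"

definition transfer ::
    "real \<Rightarrow> real \<Rightarrow> real \<Rightarrow> real \<Rightarrow> (real \<Rightarrow> real) \<Rightarrow> (real \<Rightarrow> real \<times> real) \<Rightarrow> bool" where
  "transfer u1 u2 \<gamma> T u x \<longleftrightarrow>
     0 \<le> T \<and> admissible_control u1 u2 T u \<and> trajectory_on 0 T u x \<and>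
     x 0 = (1, 0) \<and> x T = (\<gamma>, 0)"

definition optimal_trajectory ::
    "real \<Rightarrow> real \<Rightarrow> real \<Rightarrow> real \<Rightarrow> (real \<Rightarrow> real \<times> real) \<Rightarrow> bool" where
  "optimal_trajectory u1 u2 \<gamma> T x \<longleftrightarrow>
     (\<exists>u. transfer u1 u2 \<gamma> T u x) \<and>
     (\<forall>T' u' x'. transfer u1 u2 \<gamma> T' u' x' \<longrightarrow> T \<le> T')"

datatype segment_kind = Xseg | Yseg

fun control_value :: "real \<Rightarrow> real \<Rightarrow> segment_kind \<Rightarrow> real" where
  "control_value u1 u2 Xseg = - u1"
| "control_value u1 u2 Yseg = u2"

text \<open>
  \<open>x\<close> on \<open>{0..T}\<close> is the concatenation, in order, of the segments listed in \<open>w\<close>.  Every segment has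
  positive duration, so for a word with alternating letters the interior points \<open>\<tau> 1\<close> to
  \<open>\<tau> (length w - 1)\<close> are precisely the switchings.
\<close>
definition has_form ::
    "real \<Rightarrow> real \<Rightarrow> real \<Rightarrow> (real \<Rightarrow> real \<times> real) \<Rightarrow> segment_kind list \<Rightarrow> bool" where
  "has_form u1 u2 T x w \<longleftrightarrow>
     (\<exists>\<tau> :: nat \<Rightarrow> real. \<tau> 0 = 0 \<and> \<tau> (length w) = T \<and>
        (\<forall>i<length w. \<tau> i < \<tau> (Suc i) \<and>
           trajectory_on (\<tau> i) (\<tau> (Suc i)) (\<lambda>_. control_value u1 u2 (w ! i)) x))"

text \<open>The word \<open>Y(XY)\<dots>(XY)\<close> with \<open>n\<close> blocks \<open>XY\<close>, which has \<open>2 * n\<close> switchings.\<close>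
definition spiral_word :: "nat \<Rightarrow> segment_kind list" where
  "spiral_word n = Yseg # concat (replicate n [Xseg, Yseg])"

end

theory Submission
  imports Defs
begin

text \<open>
  A fastest trajectory never returns to a state, because the loop could be cut out.  The instants of
  rest (\<open>x2 = 0\<close>) cut it into humps, on which it moves right, and dips, on which it moves left.
  The word of the trajectory follows from two facts about these pieces.

  \<^emph>\<open>A hump is an arc XY and a dip is an arc YX.\<close>  Under a constant control \<open>v\<close> the energy
  \<open>x2\<^sup>2 + v x1\<^sup>2 + 1/x1\<^sup>2\<close> is conserved.  Under any admissible control a motion to the right does not
  increase the energy for \<open>- u1\<close> and does not decrease the energy for \<open>u2\<close>.  So at every position
  the velocity is at most that of the arc XY between the same two rest points, and the time is the
  integral of \<open>dx1/x2\<close>; equality of the times forces equality of the trajectories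
  (\<open>fastest_confined_right\<close>).  Dips are humps in reversed time.  Hence a hump and the dip after it
  share a Y-segment, and a dip and the hump after it share an X-segment.

  \<^emph>\<open>An inner segment makes a quarter turn.\<close>  In the coordinate \<open>w = x2/x1 + i/x1\<^sup>2\<close> of the upper half
  plane a constant control \<open>v\<close> gives the Riccati equation \<open>w' = - v - w\<^sup>2\<close>, whose flow consists of
  Moebius transformations.  Consider a segment with control \<open>v\<close> between two segments with the other
  control, and vary the three durations.  The end point and the total time can be prescribed
  independently to first order, unless the derivative of the Moebius transformation of the middle
  segment is real.  So on a fastest trajectory it is real (\<open>fastest_junction\<close>), and then the middle
  segment either spans whole periods and is a loop, or it turns the oscillator \<open>z'' = - v z\<close> with
  \<open>x1 = |z|\<close> by an odd multiple of a right angle.  Such a quarter turn replaces the slope \<open>x2/x1\<close> by its negative.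
  For an X-segment it exists only if the initial slope is below \<open>- sqrt u1\<close> (\<open>valley\<close>).

  The X-segment in the valley between a dip and a hump therefore has a duration that is bounded
  from below, so rests do not accumulate and there are finitely many pieces, which alternate.  Now
  let a trajectory start with a hump from a rest point with \<open>x1 \<ge> 1\<close>.  There all slopes of the
  X-trajectory are below \<open>sqrt u1\<close>, since \<open>u1 \<ge> 1\<close>.  If a dip follows, the Y-segment makes a quarter
  turn, and the resulting slope is too flat for the X-segment of a valley; and if the trajectory
  ends after this dip at a point with \<open>x1 \<ge> 1\<close>, then the quarter turn contradicts \<open>u2 \<ge> 1\<close>.  So the
  hump is everything (\<open>hump_from_outer_rest_is_final\<close>).  Applied to the trajectory this shows that
  it is XY or starts with a dip; applied to the reversed trajectory it shows that it does not end
  with a dip.  In the remaining case dips and humps alternate from a first dip to a last hump, and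
  merging the shared segments gives the spiral word.
\<close>

section \<open>Trajectories of measurable controls\<close>

lemma trajectory_onD:
  assumes "trajectory_on a b u x" "a \<le> t" "t \<le> b"
  shows "((\<lambda>s. vector_field (u s) (x s)) has_integral (x t - x a)) {a..t}"
    and "x t \<in> state_space"
  using assms(1)[unfolded trajectory_on_def, rule_format, of t] assms(2,3) by simp_all

lemma trajectory_on_has_integral:
  assumes "trajectory_on a b u x" "a \<le> c" "c \<le> d" "d \<le> b"
  shows "((\<lambda>s. vector_field (u s) (x s)) has_integral (x d - x c)) {c..d}"
proof -
  let ?f = "\<lambda>s. vector_field (u s) (x s)"
  have ac: "(?f has_integral (x c - x a)) {a..c}" and ad: "(?f has_integral (x d - x a)) {a..d}"
    using trajectory_onD(1)[OF assms(1)] assms(2-4) by simp_all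
  have "?f integrable_on {c..d}"
    by (rule integrable_subinterval_real[OF has_integral_integrable[OF ad]]) (use assms(2) in simp)
  then obtain j where j: "(?f has_integral j) {c..d}"
    by blast
  have "(?f has_integral (x c - x a + j)) {a..d}"
    using has_integral_combine[OF assms(2,3) ac j] .
  then have "j = x d - x c"
    using has_integral_unique[OF ad] by (simp add: algebra_simps)
  with j show ?thesis by simp
qed

lemma trajectory_on_state_space:
  "trajectory_on a b u x \<Longrightarrow> t \<in> {a..b} \<Longrightarrow> 0 < fst (x t)"
  using trajectory_onD(2)[of a b u x t] by (simp add: state_space_def)

lemma trajectory_on_subinterval:
  assumes "trajectory_on a b u x" "a \<le> c" "d \<le> b"
  shows "trajectory_on c d u x"
  unfolding trajectory_on_def
proof
  fix t assume "t \<in> {c..d}"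
  then show "x t \<in> state_space \<and>
      ((\<lambda>s. vector_field (u s) (x s)) has_integral (x t - x c)) {c..t}"
    using trajectory_on_has_integral[OF assms(1), of c t] trajectory_onD(2)[OF assms(1), of t]
      assms(2,3) by simp
qed

lemma trajectory_on_cong:
  assumes "trajectory_on a b u x" "\<And>t. t \<in> {a..b} \<Longrightarrow> y t = x t"
    and "\<And>t. a \<le> t \<Longrightarrow> t \<le> b \<Longrightarrow> v t = u t"
  shows "trajectory_on a b v y"
  unfolding trajectory_on_def
proof
  fix t assume t: "t \<in> {a..b}"
  have "((\<lambda>s. vector_field (u s) (x s)) has_integral (x t - x a)) {a..t}"
    using trajectory_onD(1)[OF assms(1)] t by simp
  then have "((\<lambda>s. vector_field (v s) (y s)) has_integral (x t - x a)) {a..t}"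
    by (rule has_integral_eq[rotated]) (use assms t in auto)
  then show "y t \<in> state_space \<and>
      ((\<lambda>s. vector_field (v s) (y s)) has_integral (y t - y a)) {a..t}"
    using trajectory_onD(2)[OF assms(1), of t] assms(2)[of t] assms(2)[of a] t by simp
qed

lemma trajectory_on_concat:
  assumes 1: "trajectory_on a b u x" and 2: "trajectory_on b c v x" and "a \<le> b" "b \<le> c"
  shows "trajectory_on a c (\<lambda>t. if t \<le> b then u t else v t) x"
  unfolding trajectory_on_def
proof
  let ?w = "\<lambda>t. if t \<le> b then u t else v t"
  fix t assume t: "t \<in> {a..c}"
  have A: "((\<lambda>s. vector_field (?w s) (x s)) has_integral (x s - x a)) {a..s}" if "s \<in> {a..b}" for s
    by (rule has_integral_eq[OF _ trajectory_onD(1)[OF 1]]) (use that in auto)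
  have B: "((\<lambda>s. vector_field (?w s) (x s)) has_integral (x t - x b)) {b..t}" if "b \<le> t"
  proof (rule has_integral_spike_finite[of "{b}" _ _ "\<lambda>s. vector_field (v s) (x s)"])
    show "((\<lambda>s. vector_field (v s) (x s)) has_integral x t - x b) {b..t}"
      using trajectory_onD(1)[OF 2] t that by simp
  qed auto
  have "((\<lambda>s. vector_field (?w s) (x s)) has_integral (x t - x a)) {a..t}"
  proof (cases "t \<le> b")
    case True
    then show ?thesis using A[of t] t by simp
  next
    case False
    then show ?thesis
      using has_integral_combine[OF assms(3) _ A[of b] B] assms(3) by simp
  qed
  moreover have "x t \<in> state_space"
    using trajectory_onD(2)[OF 1] trajectory_onD(2)[OF 2] t by (cases "t \<le> b") simp_all
  ultimately show "x t \<in> state_space \<and>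
      ((\<lambda>s. vector_field (?w s) (x s)) has_integral (x t - x a)) {a..t}"
    by blast
qed

lemma trajectory_on_shift:
  assumes "trajectory_on a b u x"
  shows "trajectory_on (a + h) (b + h) (\<lambda>t. u (t - h)) (\<lambda>t. x (t - h))"
  unfolding trajectory_on_def
proof
  fix t assume t: "t \<in> {a + h..b + h}"
  have "((\<lambda>s. vector_field (u s) (x s)) has_integral (x (t - h) - x a)) (cbox a (t - h))"
    using trajectory_onD(1)[OF assms, of "t - h"] t by simp
  from has_integral_affinity'[OF this, of 1 "- h"] trajectory_onD(2)[OF assms, of "t - h"] t
  show "x (t - h) \<in> state_space \<and>
      ((\<lambda>s. vector_field (u (s - h)) (x (s - h))) has_integral (x (t - h) - x (a + h - h))) {a + h..t}"
    by simp
qed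

text \<open>The system is reversible: the acceleration does not depend on the velocity, so running a trajectory
  backwards and reflecting the velocity gives a trajectory again.\<close>

definition time_reverse :: "(real \<Rightarrow> real \<times> real) \<Rightarrow> real \<Rightarrow> real \<times> real" where
  "time_reverse x t = (fst (x (- t)), - snd (x (- t)))"

lemma time_reverse_simps [simp]:
  "fst (time_reverse x t) = fst (x (- t))" "snd (time_reverse x t) = - snd (x (- t))"
  "time_reverse (time_reverse x) = x"
  by (auto simp: time_reverse_def)

lemma trajectory_on_time_reverse:
  assumes "trajectory_on a b u x"
  shows "trajectory_on (- b) (- a) (\<lambda>t. u (- t)) (time_reverse x)"
  unfolding trajectory_on_def
proof
  fix t assume t: "t \<in> {- b..- a}"
  let ?L = "\<lambda>p :: real \<times> real. (- fst p, snd p)"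
  have "bounded_linear ?L"
    by (intro bounded_linear_Pair bounded_linear_minus bounded_linear_fst bounded_linear_snd)
  moreover have "((\<lambda>s. vector_field (u s) (x s)) has_integral (x b - x (- t))) {- t..b}"
    using trajectory_on_has_integral[OF assms, of "- t" b] t by auto
  then have "((\<lambda>s. vector_field (u (- s)) (x (- s))) has_integral (x b - x (- t))) {- b..t}"
    using has_integral_reflect_real[of "\<lambda>s. vector_field (u s) (x s)" _ b "- t"] by simp
  ultimately have "(?L \<circ> (\<lambda>s. vector_field (u (- s)) (x (- s))) has_integral ?L (x b - x (- t))) {- b..t}"
    using has_integral_linear by blast
  then have "((\<lambda>s. vector_field (u (- s)) (time_reverse x s)) has_integral
      (time_reverse x t - time_reverse x (- b))) {- b..t}"
    by (simp add: o_def vector_field_def time_reverse_def)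
  moreover have "time_reverse x t \<in> state_space"
    using trajectory_on_state_space[OF assms, of "- t"] t by (simp add: state_space_def)
  ultimately show "time_reverse x t \<in> state_space \<and>
      ((\<lambda>s. vector_field (u (- s)) (time_reverse x s)) has_integral
        (time_reverse x t - time_reverse x (- b))) {- b..t}"
    by blast
qed

lemma trajectory_on_continuous:
  assumes "trajectory_on a b u x"
  shows "continuous_on {a..b} x"
proof (cases "a \<le> b")
  case True
  let ?f = "\<lambda>s. vector_field (u s) (x s)"
  have "?f integrable_on {a..b}"
    using trajectory_onD(1)[OF assms, of b] True by blast
  then have "continuous_on {a..b} (\<lambda>t. x a + integral {a..t} ?f)"
    by (intro continuous_intros indefinite_integral_continuous_1)
  moreover have "x a + integral {a..t} ?f = x t" if "t \<in> {a..b}" for t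
  proof -
    have "integral {a..t} ?f = x t - x a"
      using trajectory_onD(1)[OF assms, of t] that by (intro integral_unique) simp
    then show ?thesis by simp
  qed
  ultimately show ?thesis
    by (rule continuous_on_eq)
qed auto

lemma trajectory_on_fst_derivative:
  assumes "trajectory_on a b u x" "t \<in> {a..b}"
  shows "((\<lambda>t. fst (x t)) has_real_derivative snd (x t)) (at t within {a..b})"
proof -
  have cont: "continuous_on {a..b} (\<lambda>t. snd (x t))"
    by (intro continuous_intros trajectory_on_continuous[OF assms(1)])
  have eq: "fst (x a) + integral {a..s} (\<lambda>t. snd (x t)) = fst (x s)" if "s \<in> {a..b}" for s
  proof -
    have "((\<lambda>s. vector_field (u s) (x s)) has_integral (x s - x a)) {a..s}"
      using trajectory_onD(1)[OF assms(1), of s] that by simp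
    from has_integral_linear[OF this bounded_linear_fst]
    have "integral {a..s} (\<lambda>t. snd (x t)) = fst (x s) - fst (x a)"
      by (intro integral_unique) (simp add: o_def vector_field_def)
    then show ?thesis by simp
  qed
  have "((\<lambda>s. fst (x a) + integral {a..s} (\<lambda>t. snd (x t))) has_real_derivative snd (x t))
      (at t within {a..b})"
    using integral_has_vector_derivative[OF cont assms(2)]
    by (auto intro!: derivative_eq_intros simp: has_real_derivative_iff_has_vector_derivative)
  then show ?thesis
    by (rule has_field_derivative_transform_within[of _ _ _ _ 1]) (use assms eq in auto)
qed

lemma trajectory_on_snd_has_integral:
  assumes "trajectory_on a b u x" "a \<le> c" "c \<le> d" "d \<le> b"
  shows "((\<lambda>s. - u s * fst (x s) + 1 / fst (x s) ^ 3) has_integral (snd (x d) - snd (x c))) {c..d}"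
  using has_integral_linear[OF trajectory_on_has_integral[OF assms] bounded_linear_snd]
  by (simp add: o_def vector_field_def)

text \<open>Integrability already forces the control to be measurable, since it can be recovered from
  the acceleration by dividing by the positive continuous function \<open>fst \<circ> x\<close>.\<close>
lemma trajectory_on_measurable_control:
  assumes "trajectory_on a b u x" "a \<le> b"
  shows "u \<in> borel_measurable (lebesgue_on {a..b})"
proof -
  let ?acc = "\<lambda>s. - u s * fst (x s) + 1 / fst (x s) ^ 3"
  have [measurable]: "?acc \<in> borel_measurable (lebesgue_on {a..b})"
    using trajectory_on_snd_has_integral[OF assms(1), of a b] assms(2)
    by (intro integrable_imp_measurable) blast
  have [measurable]: "(\<lambda>s. fst (x s)) \<in> borel_measurable (lebesgue_on {a..b})"
    by (intro continuous_imp_measurable_on_sets_lebesgue continuous_intros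
        trajectory_on_continuous[OF assms(1)]) auto
  have A: "(\<lambda>s. (1 / fst (x s) ^ 3 - ?acc s) / fst (x s)) \<in> borel_measurable (lebesgue_on {a..b})"
    by measurable
  have B: "u s = (1 / fst (x s) ^ 3 - ?acc s) / fst (x s)" if "s \<in> space (lebesgue_on {a..b})" for s
    using trajectory_on_state_space[OF assms(1), of s] that by simp
  show ?thesis
    by (rule measurable_cong[THEN iffD2, OF B A])
qed

abbreviation const_arc :: "real \<Rightarrow> real \<Rightarrow> real \<Rightarrow> (real \<Rightarrow> real \<times> real) \<Rightarrow> bool" where
  "const_arc v a b x \<equiv> trajectory_on a b (\<lambda>_. v) x"

lemma const_arc_iff_derivative:
  assumes "a \<le> b"
  shows "const_arc v a b x \<longleftrightarrow> (\<forall>t\<in>{a..b}. 0 < fst (x t) \<and>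
    (x has_vector_derivative vector_field v (x t)) (at t within {a..b}))"
proof safe
  fix t assume x: "const_arc v a b x" and t: "t \<in> {a..b}"
  show "0 < fst (x t)"
    using trajectory_on_state_space[OF x t] .
  have pos: "fst (x s) \<noteq> 0" if "s \<in> {a..b}" for s
    using trajectory_on_state_space[OF x that] by simp
  have "continuous_on {a..b} (\<lambda>s. vector_field v (x s))"
    unfolding vector_field_def
    by (intro continuous_intros trajectory_on_continuous[OF x]) (use pos in auto)
  from integral_has_vector_derivative[OF this t]
  have "((\<lambda>s. x a + integral {a..s} (\<lambda>s. vector_field v (x s))) has_vector_derivative
      vector_field v (x t)) (at t within {a..b})"
    by (auto intro!: derivative_eq_intros)
  then show "(x has_vector_derivative vector_field v (x t)) (at t within {a..b})"
  proof (rule has_vector_derivative_transform[OF t, rotated])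
    fix s assume "s \<in> {a..b}"
    then have "integral {a..s} (\<lambda>s. vector_field v (x s)) = x s - x a"
      using trajectory_onD(1)[OF x, of s] by (intro integral_unique) simp
    then show "x s = x a + integral {a..s} (\<lambda>s. vector_field v (x s))"
      by simp
  qed
next
  assume d: "\<forall>t\<in>{a..b}. 0 < fst (x t) \<and>
    (x has_vector_derivative vector_field v (x t)) (at t within {a..b})"
  show "const_arc v a b x"
    unfolding trajectory_on_def
  proof
    fix t assume t: "t \<in> {a..b}"
    have "((\<lambda>s. vector_field v (x s)) has_integral (x t - x a)) {a..t}"
    proof (rule fundamental_theorem_of_calculus)
      fix s assume "s \<in> {a..t}"
      then show "(x has_vector_derivative vector_field v (x s)) (at s within {a..t})"
        using d t by (auto intro: has_vector_derivative_within_subset[of _ _ _ "{a..b}"])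
    qed (use t in auto)
    then show "x t \<in> state_space \<and>
        ((\<lambda>s. vector_field v (x s)) has_integral (x t - x a)) {a..t}"
      using d t by (auto simp: state_space_def)
  qed
qed

lemma const_arc_concat:
  assumes "const_arc v a b x" "const_arc v b c x" "a \<le> b" "b \<le> c"
  shows "const_arc v a c x"
  using trajectory_on_concat[OF assms] by simp

section \<open>Fastest trajectories\<close>

locale bounded_control =
  fixes u1 u2 :: real
  assumes u1: "1 \<le> u1" and u2: "1 \<le> u2"
begin

text \<open>Measurability of the control is supplied by \<open>trajectory_on_measurable_control\<close>, so only its range is
  recorded; gluing, shifting and reversing then need no argument about measurable functions.\<close>

definition admissible_arc :: "real \<Rightarrow> real \<Rightarrow> (real \<Rightarrow> real \<times> real) \<Rightarrow> bool" where
  "admissible_arc a b x \<longleftrightarrow> (\<exists>u. (\<forall>t\<in>{a..b}. u t \<in> {- u1..u2}) \<and> trajectory_on a b u x)"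

definition reach :: "real \<Rightarrow> real \<times> real \<Rightarrow> real \<times> real \<Rightarrow> bool" where
  "reach T p q \<longleftrightarrow> 0 \<le> T \<and> (\<exists>y. admissible_arc 0 T y \<and> y 0 = p \<and> y T = q)"

text \<open>Optimality on an arbitrary time interval and between arbitrary states, so that it passes to
  subintervals and to the reversed trajectory.\<close>

definition fastest :: "real \<Rightarrow> real \<Rightarrow> (real \<Rightarrow> real \<times> real) \<Rightarrow> bool" where
  "fastest a b x \<longleftrightarrow> a \<le> b \<and> admissible_arc a b x \<and> (\<forall>T. reach T (x a) (x b) \<longrightarrow> b - a \<le> T)"

lemma admissible_arc_subinterval:
  "admissible_arc a b x \<Longrightarrow> a \<le> c \<Longrightarrow> d \<le> b \<Longrightarrow> admissible_arc c d x"
  unfolding admissible_arc_def by (meson atLeastatMost_subset_iff subsetD trajectory_on_subinterval)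

lemma admissible_arc_glue:
  assumes "admissible_arc a b x" "admissible_arc b c y" "x b = y b" "a \<le> b" "b \<le> c"
  shows "admissible_arc a c (\<lambda>t. if t \<le> b then x t else y t)"
proof -
  let ?z = "\<lambda>t. if t \<le> b then x t else y t"
  obtain u where u: "\<forall>t\<in>{a..b}. u t \<in> {- u1..u2}" "trajectory_on a b u x"
    using assms(1) unfolding admissible_arc_def by blast
  obtain v where v: "\<forall>t\<in>{b..c}. v t \<in> {- u1..u2}" "trajectory_on b c v y"
    using assms(2) unfolding admissible_arc_def by blast
  have "trajectory_on a b u ?z"
    by (rule trajectory_on_cong[OF u(2)]) simp_all
  moreover have "trajectory_on b c v ?z"
    by (rule trajectory_on_cong[OF v(2)]) (use assms(3) in auto)
  ultimately have "trajectory_on a c (\<lambda>t. if t \<le> b then u t else v t) ?z"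
    using assms(4,5) by (rule trajectory_on_concat)
  moreover have "\<forall>t\<in>{a..c}. (if t \<le> b then u t else v t) \<in> {- u1..u2}"
    using u(1) v(1) by simp
  ultimately show ?thesis
    unfolding admissible_arc_def by (intro exI[of _ "\<lambda>t. if t \<le> b then u t else v t"] conjI)
qed

lemma admissible_arc_shift:
  assumes "admissible_arc a b x"
  shows "admissible_arc (a + h) (b + h) (\<lambda>t. x (t - h))"
proof -
  obtain u where u: "\<forall>t\<in>{a..b}. u t \<in> {- u1..u2}" "trajectory_on a b u x"
    using assms unfolding admissible_arc_def by blast
  then show ?thesis
    unfolding admissible_arc_def by (intro exI[of _ "\<lambda>t. u (t - h)"] conjI trajectory_on_shift) auto
qed

lemma admissible_arc_time_reverse:
  assumes "admissible_arc a b x"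
  shows "admissible_arc (- b) (- a) (time_reverse x)"
proof -
  obtain u where u: "\<forall>t\<in>{a..b}. u t \<in> {- u1..u2}" "trajectory_on a b u x"
    using assms unfolding admissible_arc_def by blast
  then show ?thesis
    unfolding admissible_arc_def
    by (intro exI[of _ "\<lambda>t. u (- t)"] conjI trajectory_on_time_reverse) auto
qed

lemma admissible_arc_const:
  assumes "const_arc v a b x" "v \<in> {- u1, u2}"
  shows "admissible_arc a b x"
  unfolding admissible_arc_def using assms u1 u2 by (intro exI[of _ "\<lambda>_. v"]) auto

lemma admissible_arc_imp_reach:
  assumes "admissible_arc a b x" "a \<le> b"
  shows "reach (b - a) (x a) (x b)"
  using admissible_arc_shift[OF assms(1), of "- a"] assms(2) unfolding reach_def
  by (intro conjI exI[of _ "\<lambda>t. x (t + a)"]) simp_all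

lemma reach_trans:
  assumes "reach S p q" "reach T q r"
  shows "reach (S + T) p r"
proof -
  obtain x where x: "0 \<le> S" "admissible_arc 0 S x" "x 0 = p" "x S = q"
    using assms(1) unfolding reach_def by blast
  obtain y where y: "0 \<le> T" "admissible_arc 0 T y" "y 0 = q" "y T = r"
    using assms(2) unfolding reach_def by blast
  have "admissible_arc S (S + T) (\<lambda>t. y (t - S))"
    using admissible_arc_shift[OF y(2), of S] by (simp add: add.commute)
  from admissible_arc_glue[OF x(2) this] x y show ?thesis
    unfolding reach_def
    by (intro conjI exI[of _ "\<lambda>t. if t \<le> S then x t else y (t - S)"]) (auto split: if_splits)
qed

lemma reach_time_reverse:
  assumes "reach T p q"
  shows "reach T (fst q, - snd q) (fst p, - snd p)"
proof -
  obtain x where x: "0 \<le> T" "admissible_arc 0 T x" "x 0 = p" "x T = q"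
    using assms unfolding reach_def by blast
  from admissible_arc_imp_reach[OF admissible_arc_time_reverse[OF x(2)]] x(1,3,4)
  show ?thesis by (simp add: time_reverse_def)
qed

lemma fastestD:
  assumes "fastest a b x"
  shows "a \<le> b" "admissible_arc a b x"
  using assms by (simp_all add: fastest_def)

lemma fastest_le: "fastest a b x \<Longrightarrow> reach T (x a) (x b) \<Longrightarrow> b - a \<le> T"
  by (simp add: fastest_def)

lemma fastest_obtain_control:
  assumes "fastest a b x"
  obtains u where "\<And>t. t \<in> {a..b} \<Longrightarrow> u t \<in> {- u1..u2}" "trajectory_on a b u x"
  using fastestD(2)[OF assms] unfolding admissible_arc_def by blast

lemma fastest_subinterval:
  assumes "fastest a b x" "a \<le> c" "c \<le> d" "d \<le> b"
  shows "fastest c d x"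
proof -
  note adm = fastestD(2)[OF assms(1)]
  have "d - c \<le> T" if T: "reach T (x c) (x d)" for T
  proof -
    have "reach (c - a) (x a) (x c)" "reach (b - d) (x d) (x b)"
      using assms(2-4) by (auto intro!: admissible_arc_imp_reach admissible_arc_subinterval[OF adm])
    then have "reach (c - a + T + (b - d)) (x a) (x b)"
      using reach_trans T by blast
    with fastest_le[OF assms(1)] show ?thesis by fastforce
  qed
  moreover have "admissible_arc c d x"
    using admissible_arc_subinterval[OF adm] assms by blast
  ultimately show ?thesis
    using assms by (simp add: fastest_def)
qed

lemma fastest_time_reverse:
  assumes "fastest a b x"
  shows "fastest (- b) (- a) (time_reverse x)"
proof -
  have "b - a \<le> T" if "reach T (fst (x b), - snd (x b)) (fst (x a), - snd (x a))" for T
    using reach_time_reverse[OF that] fastest_le[OF assms] by simp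
  then show ?thesis
    using fastestD[OF assms] admissible_arc_time_reverse[of a b x]
    by (simp add: fastest_def time_reverse_def)
qed

text \<open>A loop could be cut out of the trajectory, which would save its duration.\<close>
lemma fastest_inj:
  assumes "fastest a b x" "s \<in> {a..b}" "t \<in> {a..b}" "x s = x t"
  shows "s = t"
proof -
  have *: "\<not> s < t" if st: "s \<in> {a..b}" "t \<in> {a..b}" "x s = x t" for s t
  proof
    assume "s < t"
    note adm = fastestD(2)[OF assms(1)]
    have "reach (s - a) (x a) (x s)" "reach (b - t) (x t) (x b)"
      using st(1,2) by (auto intro!: admissible_arc_imp_reach admissible_arc_subinterval[OF adm])
    then have "reach (s - a + (b - t)) (x a) (x b)"
      using reach_trans st(3) by metis
    with fastest_le[OF assms(1)] \<open>s < t\<close> show False by fastforce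
  qed
  show ?thesis using *[of s t] *[of t s] assms by force
qed

lemma fastest_pos: "fastest a b x \<Longrightarrow> t \<in> {a..b} \<Longrightarrow> 0 < fst (x t)"
  by (meson fastest_obtain_control trajectory_on_state_space)

lemma fastest_continuous: "fastest a b x \<Longrightarrow> continuous_on {a..b} x"
  by (meson fastest_obtain_control trajectory_on_continuous)

lemma fastest_fst_derivative:
  "fastest a b x \<Longrightarrow> t \<in> {a..b} \<Longrightarrow>
    ((\<lambda>t. fst (x t)) has_real_derivative snd (x t)) (at t within {a..b})"
  by (erule fastest_obtain_control) (rule trajectory_on_fst_derivative)

end

section \<open>Constant controls as a flow on the upper half plane\<close>

text \<open>\<open>gcos v\<close> and \<open>gsin v\<close> are the solutions of \<open>y'' = - v y\<close> with initial values \<open>(1, 0)\<close> and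
  \<open>(0, 1)\<close>.  They let X-segments (\<open>v < 0\<close>) and Y-segments (\<open>v > 0\<close>) share one set of formulas.\<close>

definition gcos :: "real \<Rightarrow> real \<Rightarrow> real" where
  "gcos v t = (if 0 < v then cos (sqrt v * t) else cosh (sqrt (- v) * t))"

definition gsin :: "real \<Rightarrow> real \<Rightarrow> real" where
  "gsin v t = (if 0 < v then sin (sqrt v * t) / sqrt v else sinh (sqrt (- v) * t) / sqrt (- v))"

lemma gcos_0 [simp]: "gcos v 0 = 1" and gsin_0 [simp]: "gsin v 0 = 0"
  by (simp_all add: gcos_def gsin_def)

lemma gcos_minus [simp]: "gcos v (- t) = gcos v t" and gsin_minus [simp]: "gsin v (- t) = - gsin v t"
  by (simp_all add: gcos_def gsin_def)

lemma sqrt_mult_self_minus: "v < 0 \<Longrightarrow> sqrt (- v) * sqrt (- v) = - (v :: real)"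
  by (subst real_sqrt_mult_self) simp

lemma gcos_add: "v \<noteq> 0 \<Longrightarrow> gcos v (s + t) = gcos v s * gcos v t - v * (gsin v s * gsin v t)"
  using sqrt_mult_self_minus[of v]
  by (auto simp: gcos_def gsin_def distrib_left cos_add cosh_add divide_simps)

lemma gsin_add: "v \<noteq> 0 \<Longrightarrow> gsin v (s + t) = gsin v s * gcos v t + gcos v s * gsin v t"
  by (auto simp: gcos_def gsin_def distrib_left sin_add sinh_add divide_simps)

lemma gcos_gsin_pythagoras: "v \<noteq> 0 \<Longrightarrow> gcos v t * gcos v t + v * (gsin v t * gsin v t) = 1"
  using gcos_add[of v t "- t"] by simp

lemma gcos_gsin_derivative:
  assumes "v \<noteq> 0"
  shows gcos_derivative: "(gcos v has_real_derivative - v * gsin v t) (at t within A)"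
    and gsin_derivative: "(gsin v has_real_derivative gcos v t) (at t within A)"
proof -
  consider k where "0 < k" "v = k * k" | k where "0 < k" "v = - (k * k)"
    using assms by (metis linorder_neqE_linordered_idom minus_minus neg_0_less_iff_less
        real_sqrt_gt_0_iff real_sqrt_mult_self abs_of_pos)
  then have "(gcos v has_real_derivative - v * gsin v t) (at t within A) \<and>
    (gsin v has_real_derivative gcos v t) (at t within A)"
  proof cases
    case 1
    then show ?thesis
      unfolding gcos_def[abs_def] gsin_def[abs_def] by (auto intro!: derivative_eq_intros)
  next
    case 2
    then have "\<not> 0 < v" by (simp add: not_less)
    with 2 show ?thesis
      unfolding gcos_def[abs_def] gsin_def[abs_def] by (auto intro!: derivative_eq_intros)
  qed
  then show "(gcos v has_real_derivative - v * gsin v t) (at t within A)"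
    "(gsin v has_real_derivative gcos v t) (at t within A)"
    by auto
qed

text \<open>The solution of \<open>w' = - v - w\<^sup>2\<close> with initial value \<open>w\<close>: it is \<open>z'/z\<close> for the solution
  \<open>z = gcos v + w gsin v\<close> of \<open>z'' = - v z\<close>.\<close>

definition riccati_flow :: "real \<Rightarrow> real \<Rightarrow> complex \<Rightarrow> complex" where
  "riccati_flow v t w =
     (w * of_real (gcos v t) - of_real (v * gsin v t)) / (of_real (gcos v t) + w * of_real (gsin v t))"

text \<open>A state \<open>(x1, x2)\<close> is the radial part of a planar oscillator \<open>z'' = - u z\<close> with angular momentum
  \<open>1\<close>, that is \<open>x1 = |z|\<close>, and \<open>z'/z = x2/x1 + i/x1\<^sup>2\<close>.  In this coordinate the control enters the
  equation additively and the singular term disappears.\<close>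

definition half_plane :: "real \<times> real \<Rightarrow> complex" where
  "half_plane p = Complex (snd p / fst p) (1 / (fst p)\<^sup>2)"

definition of_half_plane :: "complex \<Rightarrow> real \<times> real" where
  "of_half_plane w = (1 / sqrt (Im w), Re w / sqrt (Im w))"

lemma Im_half_plane_pos: "0 < fst p \<Longrightarrow> 0 < Im (half_plane p)"
  by (simp add: half_plane_def)

lemma of_half_plane_half_plane [simp]: "0 < fst p \<Longrightarrow> of_half_plane (half_plane p) = p"
  by (simp add: half_plane_def of_half_plane_def real_sqrt_divide prod_eq_iff)

lemma half_plane_inj: "0 < fst p \<Longrightarrow> 0 < fst q \<Longrightarrow> half_plane p = half_plane q \<Longrightarrow> p = q"
  by (metis of_half_plane_half_plane)

text \<open>The denominator is the solution \<open>z\<close> of the oscillator equation, which has nonzero angular momentum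
  and so never vanishes: the flow exists for all times.\<close>

lemma riccati_denominator_nonzero:
  assumes "v \<noteq> 0" "0 < Im w"
  shows "of_real (gcos v t) + w * of_real (gsin v t) \<noteq> (0 :: complex)"
  using gcos_gsin_pythagoras[OF assms(1), of t] assms(2)
  by (cases "gsin v t = 0") (auto simp: complex_eq_iff)

lemma riccati_flow_0 [simp]: "riccati_flow v 0 w = w"
  by (simp add: riccati_flow_def)

lemma Im_riccati_flow:
  assumes "v \<noteq> 0" "0 < Im w"
  shows "Im (riccati_flow v t w) = Im w / (cmod (of_real (gcos v t) + w * of_real (gsin v t)))\<^sup>2"
proof -
  have "gcos v t * (gcos v t * Im w) + v * (gsin v t * (gsin v t * Im w)) = Im w"
    using arg_cong[OF gcos_gsin_pythagoras[OF assms(1), of t], of "\<lambda>z. z * Im w"]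
    by (simp add: algebra_simps)
  then show ?thesis
    unfolding riccati_flow_def Im_divide cmod_power2 by (simp add: algebra_simps)
qed

lemma Im_riccati_flow_pos: "v \<noteq> 0 \<Longrightarrow> 0 < Im w \<Longrightarrow> 0 < Im (riccati_flow v t w)"
  using riccati_denominator_nonzero by (simp add: Im_riccati_flow)

lemma riccati_flow_add:
  assumes "v \<noteq> 0" "0 < Im w"
  shows "riccati_flow v (s + t) w = riccati_flow v s (riccati_flow v t w)"
proof -
  define c s' where "c = gcos v t" and "s' = gsin v t"
  define N D where "N = w * of_real c - of_real (v * s')" and "D = of_real c + w * of_real s'"
  have D: "D \<noteq> 0"
    using riccati_denominator_nonzero[OF assms] by (simp add: D_def c_def s'_def)
  have "riccati_flow v s (riccati_flow v t w) =
    (N * of_real (gcos v s) - D * of_real (v * gsin v s)) / (D * of_real (gcos v s) + N * of_real (gsin v s))"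
  proof -
    have "riccati_flow v t w = N / D"
      by (simp add: riccati_flow_def N_def D_def c_def s'_def)
    moreover have "N / D * of_real (gcos v s) - of_real (v * gsin v s)
        = (N * of_real (gcos v s) - D * of_real (v * gsin v s)) / D"
      "of_real (gcos v s) + N / D * of_real (gsin v s)
        = (D * of_real (gcos v s) + N * of_real (gsin v s)) / D"
      using D by (simp_all add: field_simps)
    ultimately show ?thesis
      using D by (simp add: riccati_flow_def[of v s])
  qed
  also have "\<dots> = riccati_flow v (s + t) w"
    unfolding riccati_flow_def gcos_add[OF assms(1)] gsin_add[OF assms(1)] N_def D_def c_def s'_def
    by (simp add: algebra_simps)
  finally show ?thesis ..
qed

lemma has_vector_derivative_quotient:
  fixes f g :: "real \<Rightarrow> complex"
  assumes "(f has_vector_derivative f') (at t within A)" "(g has_vector_derivative g') (at t within A)"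
    and "g t \<noteq> 0"
  shows "((\<lambda>t. f t / g t) has_vector_derivative (f' * g t - f t * g') / (g t)\<^sup>2) (at t within A)"
  using assms unfolding has_vector_derivative_def
  by (auto intro!: derivative_eq_intros ext
      simp: scaleR_conv_of_real field_simps power2_eq_square)

lemma riccati_flow_time_derivative:
  assumes "v \<noteq> 0" "0 < Im w"
  shows "((\<lambda>t. riccati_flow v t w) has_vector_derivative
    - of_real v - (riccati_flow v t w)\<^sup>2) (at t within A)"
proof -
  let ?N = "\<lambda>t. w * of_real (gcos v t) - of_real (v * gsin v t) :: complex"
  let ?D = "\<lambda>t. of_real (gcos v t) + w * of_real (gsin v t) :: complex"
  have c: "((\<lambda>t. of_real (gcos v t) :: complex) has_vector_derivative of_real (- v * gsin v t)) (at t within A)"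
    using has_vector_derivative_of_real[OF gcos_derivative[OF assms(1), of t A]] by simp
  have s: "((\<lambda>t. of_real (gsin v t) :: complex) has_vector_derivative of_real (gcos v t)) (at t within A)"
    using has_vector_derivative_of_real[OF gsin_derivative[OF assms(1), of t A]] by simp
  have "((\<lambda>t. w * of_real (gcos v t) - of_real v * of_real (gsin v t)) has_vector_derivative
      w * of_real (- v * gsin v t) - of_real v * of_real (gcos v t)) (at t within A)"
    by (intro has_vector_derivative_diff has_vector_derivative_mult_right c s)
  moreover have "w * of_real (- v * gsin v t) - of_real v * of_real (gcos v t) = - of_real v * ?D t"
    by (simp add: algebra_simps)
  ultimately have "(?N has_vector_derivative - of_real v * ?D t) (at t within A)"
    by simp
  moreover have "(?D has_vector_derivative of_real (- v * gsin v t) + w * of_real (gcos v t)) (at t within A)"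
    by (intro has_vector_derivative_add has_vector_derivative_mult_right c s)
  then have "(?D has_vector_derivative ?N t) (at t within A)"
    by (simp add: algebra_simps)
  ultimately have "((\<lambda>t. ?N t / ?D t) has_vector_derivative
      (- of_real v * ?D t * ?D t - ?N t * ?N t) / (?D t)\<^sup>2) (at t within A)"
    using riccati_denominator_nonzero[OF assms] by (rule has_vector_derivative_quotient)
  moreover have quotient: "(- of_real v * D * D - N * N) / D\<^sup>2 = - of_real v - (N / D)\<^sup>2"
    if "D \<noteq> 0" for N D :: complex
    using that by (simp add: field_simps power2_eq_square)
  ultimately show ?thesis
    unfolding quotient[OF riccati_denominator_nonzero[OF assms]] riccati_flow_def by blast
qed

lemma const_arc_component_derivatives:
  assumes "const_arc v a b x" "t \<in> {a..b}"
  shows "((\<lambda>t. fst (x t)) has_real_derivative snd (x t)) (at t within {a..b})"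
    and "((\<lambda>t. snd (x t)) has_real_derivative - v * fst (x t) + 1 / fst (x t) ^ 3) (at t within {a..b})"
proof -
  have "(x has_vector_derivative vector_field v (x t)) (at t within {a..b})"
    using const_arc_iff_derivative[of a b v x] assms by auto
  from bounded_linear.has_vector_derivative[OF bounded_linear_fst this]
    bounded_linear.has_vector_derivative[OF bounded_linear_snd this]
  show "((\<lambda>t. fst (x t)) has_real_derivative snd (x t)) (at t within {a..b})"
    "((\<lambda>t. snd (x t)) has_real_derivative - v * fst (x t) + 1 / fst (x t) ^ 3) (at t within {a..b})"
    by (simp_all add: has_real_derivative_iff_has_vector_derivative vector_field_def)
qed

lemma const_arc_half_plane_derivative:
  assumes "const_arc v a b x" "t \<in> {a..b}"
  shows "((\<lambda>t. half_plane (x t)) has_vector_derivative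
    - of_real v - (half_plane (x t))\<^sup>2) (at t within {a..b})"
proof -
  have pos: "0 < fst (x t)"
    using trajectory_on_state_space[OF assms] .
  note d = const_arc_component_derivatives[OF assms]
  have "((\<lambda>t. snd (x t) / fst (x t)) has_real_derivative
      - v - (snd (x t) / fst (x t))\<^sup>2 + (1 / (fst (x t))\<^sup>2)\<^sup>2) (at t within {a..b})"
    using pos
    by (auto intro!: derivative_eq_intros d simp: field_simps power2_eq_square power3_eq_cube)
  moreover have "((\<lambda>t. 1 / (fst (x t))\<^sup>2) has_real_derivative
      - (2 * (snd (x t) / fst (x t)) * (1 / (fst (x t))\<^sup>2))) (at t within {a..b})"
    using pos
    by (auto intro!: derivative_eq_intros d simp: field_simps power2_eq_square power3_eq_cube)
  ultimately have "((\<lambda>t. of_real (snd (x t) / fst (x t)) + \<i> * of_real (1 / (fst (x t))\<^sup>2))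
      has_vector_derivative
      of_real (- v - (snd (x t) / fst (x t))\<^sup>2 + (1 / (fst (x t))\<^sup>2)\<^sup>2)
      + \<i> * of_real (- (2 * (snd (x t) / fst (x t)) * (1 / (fst (x t))\<^sup>2)))) (at t within {a..b})"
    by (intro has_vector_derivative_add has_vector_derivative_mult_right has_vector_derivative_of_real)
  moreover have "of_real (- v - (snd (x t) / fst (x t))\<^sup>2 + (1 / (fst (x t))\<^sup>2)\<^sup>2)
      + \<i> * of_real (- (2 * (snd (x t) / fst (x t)) * (1 / (fst (x t))\<^sup>2)))
      = - of_real v - (half_plane (x t))\<^sup>2"
    by (simp add: half_plane_def complex_eq_iff power2_eq_square)
  moreover have "half_plane (x s) = of_real (snd (x s) / fst (x s)) + \<i> * of_real (1 / (fst (x s))\<^sup>2)" for s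
    by (simp add: half_plane_def complex_eq_iff)
  ultimately show ?thesis by (simp only:)
qed

text \<open>Uniqueness of solutions.  Transporting \<open>half_plane (x s)\<close> back to time \<open>a\<close> by the flow gives a
  quotient in which numerator and denominator both have logarithmic derivative \<open>- half_plane (x s)\<close>,
  so the quotient is constant.\<close>

lemma const_arc_eq_riccati_flow:
  assumes x: "const_arc v a b x" and v: "v \<noteq> 0" and t: "t \<in> {a..b}"
  shows "half_plane (x t) = riccati_flow v (t - a) (half_plane (x a))"
proof -
  let ?W = "\<lambda>s. half_plane (x s)"
  let ?C = "\<lambda>s. of_real (gcos v (s - a)) :: complex"
  let ?S = "\<lambda>s. of_real (gsin v (s - a)) :: complex"
  let ?N = "\<lambda>s. ?W s * ?C s + of_real v * ?S s" and ?D = "\<lambda>s. ?C s - ?W s * ?S s"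
  have pos: "0 < Im (?W s)" if "s \<in> {a..b}" for s
    using Im_half_plane_pos trajectory_on_state_space[OF x that] by blast
  have D: "?D s \<noteq> 0" if "s \<in> {a..b}" for s
    using riccati_denominator_nonzero[OF v pos[OF that], of "- (s - a)"]
    unfolding gcos_minus gsin_minus by simp
  have "((\<lambda>s. ?N s / ?D s) has_vector_derivative 0) (at s within {a..b})" if s: "s \<in> {a..b}" for s
  proof -
    note W = const_arc_half_plane_derivative[OF x s]
    have shift: "((\<lambda>s. s - a) has_real_derivative 1) (at s within {a..b})"
      by (auto intro!: derivative_eq_intros)
    have "((\<lambda>s. gcos v (s - a)) has_real_derivative - v * gsin v (s - a)) (at s within {a..b})"
      using DERIV_chain2[where f = "gcos v" and g = "\<lambda>s. s - a", OF gcos_derivative[OF v] shift] by simp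
    from has_vector_derivative_of_real[OF this]
    have C: "(?C has_vector_derivative - of_real v * ?S s) (at s within {a..b})"
      by simp
    have "((\<lambda>s. gsin v (s - a)) has_real_derivative gcos v (s - a)) (at s within {a..b})"
      using DERIV_chain2[where f = "gsin v" and g = "\<lambda>s. s - a", OF gsin_derivative[OF v] shift] by simp
    from has_vector_derivative_of_real[OF this]
    have S: "(?S has_vector_derivative ?C s) (at s within {a..b})"
      by simp
    have "(?N has_vector_derivative
        (?W s * (- of_real v * ?S s) + (- of_real v - (?W s)\<^sup>2) * ?C s) + of_real v * ?C s) (at s within {a..b})"
      by (intro has_vector_derivative_add has_vector_derivative_mult has_vector_derivative_mult_right W C S)
    moreover have "(?D has_vector_derivative
        - of_real v * ?S s - (?W s * ?C s + (- of_real v - (?W s)\<^sup>2) * ?S s)) (at s within {a..b})"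
      by (intro has_vector_derivative_diff has_vector_derivative_mult W C S)
    ultimately have "((\<lambda>s. ?N s / ?D s) has_vector_derivative
      (((?W s * (- of_real v * ?S s) + (- of_real v - (?W s)\<^sup>2) * ?C s) + of_real v * ?C s) * ?D s
        - ?N s * (- of_real v * ?S s - (?W s * ?C s + (- of_real v - (?W s)\<^sup>2) * ?S s))) / (?D s)\<^sup>2)
      (at s within {a..b})"
      by (rule has_vector_derivative_quotient) (rule D[OF s])
    moreover have "((?W s * (- of_real v * ?S s) + (- of_real v - (?W s)\<^sup>2) * ?C s) + of_real v * ?C s) * ?D s
        - ?N s * (- of_real v * ?S s - (?W s * ?C s + (- of_real v - (?W s)\<^sup>2) * ?S s)) = 0"
      by (simp add: algebra_simps power2_eq_square)
    ultimately show ?thesis by simp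
  qed
  then obtain k where k: "\<And>s. s \<in> {a..b} \<Longrightarrow> ?N s / ?D s = k"
    using has_vector_derivative_zero_constant[of "{a..b}" "\<lambda>s. ?N s / ?D s"] by auto
  have "riccati_flow v (- (t - a)) (?W t) = ?N t / ?D t"
    unfolding riccati_flow_def gcos_minus gsin_minus by simp
  also have "\<dots> = ?N a / ?D a"
    using k[of t] k[of a] t by simp
  finally have "riccati_flow v (- (t - a)) (?W t) = ?W a"
    by simp
  then have "riccati_flow v (t - a) (?W a) = riccati_flow v ((t - a) + - (t - a)) (?W t)"
    using riccati_flow_add[OF v pos[OF t], of "t - a" "- (t - a)"] by simp
  then show ?thesis by simp
qed

lemma const_arc_riccati_flow:
  assumes v: "v \<noteq> 0" and w: "0 < Im w" and "a \<le> b"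
  shows "const_arc v a b (\<lambda>t. of_half_plane (riccati_flow v (t - c) w))"
  unfolding const_arc_iff_derivative[OF assms(3)]
proof (intro ballI conjI)
  fix t
  let ?W = "\<lambda>t. riccati_flow v (t - c) w"
  have pos: "0 < Im (?W t)"
    using Im_riccati_flow_pos[OF v w] .
  show "0 < fst (of_half_plane (?W t))"
    using pos by (simp add: of_half_plane_def)
  have "((\<lambda>t. riccati_flow v t w) \<circ> (\<lambda>t. t - c) has_vector_derivative 1 *\<^sub>R (- of_real v - (?W t)\<^sup>2)) (at t within {a..b})"
    by (intro vector_diff_chain_within riccati_flow_time_derivative[OF v w])
      (auto intro!: derivative_eq_intros)
  then have d: "(?W has_vector_derivative - of_real v - (?W t)\<^sup>2) (at t within {a..b})"
    by (simp add: o_def)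
  have p: "((\<lambda>t. Re (?W t)) has_real_derivative - v - (Re (?W t))\<^sup>2 + (Im (?W t))\<^sup>2) (at t within {a..b})"
    using bounded_linear.has_vector_derivative[OF bounded_linear_Re d]
    by (simp add: has_real_derivative_iff_has_vector_derivative power2_eq_square algebra_simps)
  have q: "((\<lambda>t. Im (?W t)) has_real_derivative - 2 * Re (?W t) * Im (?W t)) (at t within {a..b})"
    using bounded_linear.has_vector_derivative[OF bounded_linear_Im d]
    by (simp add: has_real_derivative_iff_has_vector_derivative power2_eq_square algebra_simps)
  define k where "k = sqrt (Im (?W t))"
  have k: "0 < k" "Im (?W t) = k * k"
    using pos by (simp_all add: k_def)
  have sq: "((\<lambda>t. sqrt (Im (?W t))) has_real_derivative - Re (?W t) * k) (at t within {a..b})"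
    by (rule DERIV_cong[OF DERIV_chain2[OF DERIV_real_sqrt q]])
      (use k pos in \<open>simp_all add: k_def[symmetric] field_simps\<close>)
  define P R where "P = (\<lambda>t. Re (?W t))" and "R = (\<lambda>t. sqrt (Im (?W t)))"
  have P: "(P has_real_derivative - v - (P t)\<^sup>2 + (k * k)\<^sup>2) (at t within {a..b})"
    and R: "(R has_real_derivative - P t * k) (at t within {a..b})" and Rk: "R t = k"
    using p sq k by (simp_all add: P_def R_def k_def[symmetric])
  have "((\<lambda>t. 1 / R t) has_real_derivative P t / k) (at t within {a..b})"
    using k(1) by (auto intro!: derivative_eq_intros R simp: Rk field_simps)
  moreover have "((\<lambda>t. P t / R t) has_real_derivative - v * (1 / k) + k ^ 3) (at t within {a..b})"
    using k(1) by (auto intro!: derivative_eq_intros R P simp: Rk)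
      (simp add: field_simps power2_eq_square power3_eq_cube)
  ultimately have x12: "((\<lambda>t. 1 / sqrt (Im (?W t))) has_real_derivative Re (?W t) / k) (at t within {a..b})"
    "((\<lambda>t. Re (?W t) / sqrt (Im (?W t))) has_real_derivative - v * (1 / k) + k ^ 3) (at t within {a..b})"
    by (simp_all add: P_def R_def)
  have "((\<lambda>t. (1 / sqrt (Im (?W t)), Re (?W t) / sqrt (Im (?W t)))) has_vector_derivative
      (Re (?W t) / k, - v * (1 / k) + k ^ 3)) (at t within {a..b})"
    using x12 unfolding has_real_derivative_iff_has_vector_derivative
    by (rule has_vector_derivative_Pair)
  then show "((\<lambda>t. of_half_plane (?W t)) has_vector_derivative
      vector_field v (of_half_plane (?W t))) (at t within {a..b})"
    using k(1) by (simp add: of_half_plane_def vector_field_def k_def[symmetric] field_simps)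
qed

lemma (in bounded_control) reach_riccati_flow:
  assumes "v \<in> {- u1, u2}" "0 < Im w" "0 \<le> t"
  shows "reach t (of_half_plane w) (of_half_plane (riccati_flow v t w))"
proof -
  have "v \<noteq> 0" using assms(1) u1 u2 by auto
  from admissible_arc_imp_reach[OF admissible_arc_const[OF const_arc_riccati_flow[OF this assms(2,3), of 0] assms(1)] assms(3)]
  show ?thesis by simp
qed

definition energy :: "real \<Rightarrow> real \<times> real \<Rightarrow> real" where
  "energy v p = (snd p)\<^sup>2 + v * (fst p)\<^sup>2 + 1 / (fst p)\<^sup>2"

lemma const_arc_energy:
  assumes "const_arc v a b x" "s \<in> {a..b}" "t \<in> {a..b}"
  shows "energy v (x s) = energy v (x t)"
proof -
  have "((\<lambda>t. energy v (x t)) has_real_derivative 0) (at r within {a..b})" if r: "r \<in> {a..b}" for r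
    unfolding energy_def using trajectory_on_state_space[OF assms(1) r]
    by (auto intro!: derivative_eq_intros const_arc_component_derivatives[OF assms(1) r]
        simp: field_simps power2_eq_square power3_eq_cube)
  then obtain k where "\<And>r. r \<in> {a..b} \<Longrightarrow> energy v (x r) = k"
    using has_field_derivative_zero_constant[of "{a..b}" "\<lambda>t. energy v (x t)"] by auto
  with assms show ?thesis by simp
qed

section \<open>The junction condition\<close>

lemma riccati_flow_has_derivative:
  fixes h :: "'a::real_normed_vector \<Rightarrow> real" and w :: "'a \<Rightarrow> complex"
  assumes v: "v \<noteq> 0" and pos: "0 < Im (w z)"
    and h: "(h has_derivative h') (at z)" and w: "(w has_derivative w') (at z)"
  shows "((\<lambda>z. riccati_flow v (h z) (w z)) has_derivative
    (\<lambda>d. (- of_real v - (riccati_flow v (h z) (w z))\<^sup>2) * of_real (h' d)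
       + w' d / (of_real (gcos v (h z)) + w z * of_real (gsin v (h z)))\<^sup>2)) (at z)"
proof -
  define c s where "c = (of_real (gcos v (h z)) :: complex)" and "s = (of_real (gsin v (h z)) :: complex)"
  have cs: "c * c + of_real v * (s * s) = 1"
    using arg_cong[OF gcos_gsin_pythagoras[OF v, of "h z"], of "of_real :: real \<Rightarrow> complex"]
    by (simp add: c_def s_def)
  have C: "((\<lambda>z. of_real (gcos v (h z)) :: complex) has_derivative
      (\<lambda>d. - of_real v * s * of_real (h' d))) (at z)"
    using has_derivative_of_real[OF has_derivative_compose[OF h
          gcos_derivative[OF v, of "h z" UNIV, unfolded has_field_derivative_def]]]
    by (simp add: s_def mult.assoc)
  have S: "((\<lambda>z. of_real (gsin v (h z)) :: complex) has_derivative (\<lambda>d. c * of_real (h' d))) (at z)"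
    using has_derivative_of_real[OF has_derivative_compose[OF h
          gsin_derivative[OF v, of "h z" UNIV, unfolded has_field_derivative_def]]]
    by (simp add: c_def)
  let ?N = "\<lambda>z. w z * of_real (gcos v (h z)) - of_real v * of_real (gsin v (h z))"
  let ?D = "\<lambda>z. of_real (gcos v (h z)) + w z * of_real (gsin v (h z))"
  have D: "?D z \<noteq> 0"
    using riccati_denominator_nonzero[OF v pos] .
  have "(?N has_derivative (\<lambda>d. (w z * (- of_real v * s * of_real (h' d)) + w' d * c)
      - of_real v * (c * of_real (h' d)))) (at z)"
    using has_derivative_diff[OF has_derivative_mult[OF w C] has_derivative_mult_right[OF S, of "of_real v"]]
    by (simp add: c_def)
  moreover have "(?D has_derivative (\<lambda>d. - of_real v * s * of_real (h' d)
      + (w z * (c * of_real (h' d)) + w' d * s))) (at z)"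
    using has_derivative_add[OF C has_derivative_mult[OF w S]]
    by (simp add: s_def)
  ultimately have "((\<lambda>z. ?N z / ?D z) has_derivative
     (\<lambda>d. (((w z * (- of_real v * s * of_real (h' d)) + w' d * c) - of_real v * (c * of_real (h' d))) * ?D z
       - ?N z * (- of_real v * s * of_real (h' d) + (w z * (c * of_real (h' d)) + w' d * s)))
       / (?D z * ?D z))) (at z)"
    using D by (rule has_derivative_divide')
  moreover have "(((w z * (- of_real v * s * of_real (h' d)) + w' d * c) - of_real v * (c * of_real (h' d))) * ?D z
       - ?N z * (- of_real v * s * of_real (h' d) + (w z * (c * of_real (h' d)) + w' d * s)))
       / (?D z * ?D z)
     = (- of_real v - (?N z / ?D z)\<^sup>2) * of_real (h' d) + w' d / (?D z)\<^sup>2" (is "?L / _ = _") for d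
  proof -
    have "?L = (- of_real v * (?D z * ?D z) - ?N z * ?N z) * of_real (h' d)
        + w' d * (c * c + of_real v * (s * s))"
      by (simp add: c_def[symmetric] s_def[symmetric] algebra_simps)
    then have L: "?L = (- of_real v * (?D z * ?D z) - ?N z * ?N z) * of_real (h' d) + w' d"
      by (simp only: cs mult_1_right)
    have alg: "((- of_real v * (D * D) - N * N) * k + l) / (D * D)
        = (- of_real v - (N / D)\<^sup>2) * k + l / D\<^sup>2" if "D \<noteq> 0" for N D k l :: complex
      using that by (simp add: field_simps power2_eq_square)
    show ?thesis
      unfolding L by (rule alg[OF D])
  qed
  ultimately show ?thesis
    by (simp add: riccati_flow_def)
qed

lemma continuous_on_riccati_flow:
  fixes h :: "'a::topological_space \<Rightarrow> real" and w :: "'a \<Rightarrow> complex"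
  assumes v: "v \<noteq> 0" and pos: "\<And>z. z \<in> A \<Longrightarrow> 0 < Im (w z)"
    and h: "continuous_on A h" and w: "continuous_on A w"
  shows "continuous_on A (\<lambda>z. riccati_flow v (h z) (w z))"
proof -
  have "isCont (gcos v) t" "isCont (gsin v) t" for t
    using gcos_derivative[OF v] gsin_derivative[OF v] DERIV_isCont by blast+
  then have "continuous_on A (\<lambda>z. gcos v (h z))" "continuous_on A (\<lambda>z. gsin v (h z))"
    by (auto intro!: continuous_on_compose2[of UNIV _ A h] h continuous_at_imp_continuous_on)
  then show ?thesis
    unfolding riccati_flow_def
    by (intro continuous_intros w) (use riccati_denominator_nonzero[OF v pos] in auto)
qed

text \<open>The variation of the three durations of a segment with control \<open>v\<close> between two segments with
  control \<open>v'\<close>.  Write \<open>D\<close> for the denominator of the flow over the middle segment, so that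
  \<open>1/D\<^sup>2\<close> is its derivative in \<open>w\<close>.  Relative to the velocity under \<open>v\<close> at the end point, the
  velocities under \<open>v'\<close> at the two junctions push the end point into the directions \<open>1/D\<^sup>2\<close> and \<open>1\<close>.
  The two assumptions on \<open>gsin\<close> and \<open>gcos\<close> say that \<open>D\<^sup>2\<close> is not real, so these directions span the
  plane, and the map from the durations to the end point and the total time is open at the
  unperturbed durations.  In particular the same end point is reached in a shorter total time.\<close>

lemma riccati_flow_shortcut:
  assumes v: "v \<noteq> 0" "v' \<noteq> 0" "v \<noteq> v'" and W: "0 < Im w"
    and S: "gsin v \<tau> \<noteq> 0" and CS: "gcos v \<tau> + Re w * gsin v \<tau> \<noteq> 0" and e: "0 < e"
  obtains s1 s2 s3 where "\<bar>s1\<bar> < e" "\<bar>s2\<bar> < e" "\<bar>s3\<bar> < e" "s1 + s2 + s3 < 0"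
    "riccati_flow v' s3 (riccati_flow v (\<tau> + s2) (riccati_flow v' s1 w)) = riccati_flow v \<tau> w"
proof -
  define f :: "real \<times> real \<times> real \<Rightarrow> complex \<times> real" where
    "f = (\<lambda>z. (riccati_flow v' (snd (snd z)) (riccati_flow v (\<tau> + fst (snd z)) (riccati_flow v' (fst z) w)),
      fst z + fst (snd z) + snd (snd z)))"
  define D where "D = of_real (gcos v \<tau>) + w * of_real (gsin v \<tau>)"
  define w2 where "w2 = riccati_flow v \<tau> w"
  define k where "k = 1 / D\<^sup>2"
  have D: "D \<noteq> 0"
    unfolding D_def by (rule riccati_denominator_nonzero[OF v(1) W])
  have "Im (D\<^sup>2) = 2 * (gcos v \<tau> + Re w * gsin v \<tau>) * (Im w * gsin v \<tau>)"
    by (simp add: D_def power2_eq_square algebra_simps)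
  then have "Im (D\<^sup>2) \<noteq> 0"
    using S CS W by simp
  then have k: "Im k \<noteq> 0"
    using D by (simp add: k_def Im_divide)
  define f' :: "real \<times> real \<times> real \<Rightarrow> complex \<times> real" where
    "f' = (\<lambda>d. ((- of_real v' - w2\<^sup>2) * of_real (snd (snd d))
        + ((- of_real v - w2\<^sup>2) * of_real (fst (snd d)) + (- of_real v' - w\<^sup>2) * of_real (fst d) * k),
      fst d + fst (snd d) + snd (snd d)))"
  have "(f has_derivative f') (at 0)"
  proof -
    have *: "((\<lambda>z::real \<times> real \<times> real. fst z) has_derivative fst) (at 0)"
      "((\<lambda>z::real \<times> real \<times> real. \<tau> + fst (snd z)) has_derivative (\<lambda>z. fst (snd z))) (at 0)"
      "((\<lambda>z::real \<times> real \<times> real. snd (snd z)) has_derivative (\<lambda>z. snd (snd z))) (at 0)"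
      by (auto intro!: derivative_eq_intros)
    note d1 = riccati_flow_has_derivative[OF v(2) _ *(1) has_derivative_const[of w], simplified, OF W]
    have p1: "0 < Im (riccati_flow v' (fst (0 :: real \<times> real \<times> real)) w)"
      using W by simp
    note d2 = riccati_flow_has_derivative[OF v(1) p1 *(2) d1]
    have p2: "0 < Im (riccati_flow v (\<tau> + fst (snd (0 :: real \<times> real \<times> real)))
        (riccati_flow v' (fst (0 :: real \<times> real \<times> real)) w))"
      by (intro Im_riccati_flow_pos v p1)
    note d3 = riccati_flow_has_derivative[OF v(2) p2 *(3) d2]
    have "f' = (\<lambda>d. ((- of_real v' - w2\<^sup>2) * of_real (snd (snd d))
        + ((- of_real v - w2\<^sup>2) * of_real (fst (snd d)) + (- of_real v' - w\<^sup>2) * of_real (fst d) / D\<^sup>2) / 1,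
      fst d + fst (snd d) + snd (snd d)))"
      by (simp add: f'_def k_def)
    moreover have "(f has_derivative (\<lambda>d. ((- of_real v' - w2\<^sup>2) * of_real (snd (snd d))
        + ((- of_real v - w2\<^sup>2) * of_real (fst (snd d)) + (- of_real v' - w\<^sup>2) * of_real (fst d) / D\<^sup>2) / 1,
      fst d + fst (snd d) + snd (snd d)))) (at 0)"
      unfolding f_def
      by (rule has_derivative_Pair)
        (use d3 in \<open>auto intro!: derivative_eq_intros simp: w2_def D_def\<close>)
    ultimately show ?thesis by simp
  qed
  moreover
  \<comment> \<open>\<open>f'\<close> is inverted by hand: \<open>Z\<close> is what remains of the prescribed displacement once the velocity
    \<open>B\<close> under \<open>v\<close> has been subtracted, and \<open>d1\<close> and \<open>d3\<close> are its coordinates with respect to \<open>k\<close> and \<open>1\<close>.\<close>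
  define B where "B = - of_real v - w2\<^sup>2"
  define Z :: "complex \<times> real \<Rightarrow> complex" where
    "Z = (\<lambda>y. (1 / (v - v')) *\<^sub>R (fst y - B * of_real (snd y)))"
  define d1 where "d1 = (\<lambda>y. Im (Z y) / Im k)"
  define d3 where "d3 = (\<lambda>y. Re (Z y) - d1 y * Re k)"
  define g where "g = (\<lambda>y. (d1 y, snd y - d1 y - d3 y, d3 y))"
  have "bounded_linear Z"
    unfolding Z_def
    by (intro bounded_linear_intros bounded_linear_compose[OF bounded_linear_of_real])
  note Z = bounded_linear_compose[OF bounded_linear_Re this] bounded_linear_compose[OF bounded_linear_Im this]
  have d1: "bounded_linear d1"
    unfolding d1_def by (rule bounded_linear_compose[OF bounded_linear_divide Z(2)])
  have d3: "bounded_linear d3"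
    unfolding d3_def
    by (rule bounded_linear_sub[OF Z(1) bounded_linear_compose[OF bounded_linear_mult_left d1]])
  have "bounded_linear g"
    unfolding g_def
    by (intro bounded_linear_Pair bounded_linear_sub bounded_linear_snd d1 d3)
  moreover have "f' \<circ> g = id"
  proof
    fix y :: "complex \<times> real"
    have "of_real (d3 y) + k * of_real (d1 y) = Z y"
      using k by (simp add: complex_eq_iff d3_def d1_def)
    moreover have "of_real (v - v') * Z y = fst y - B * of_real (snd y)"
      using v(3) by (simp add: Z_def scaleR_conv_of_real)
    ultimately have e1: "B * of_real (snd y) + of_real (v - v') * (of_real (d3 y) + k * of_real (d1 y)) = fst y"
      by simp
    have e2: "(- of_real v' - w\<^sup>2) * k = B + of_real (v - v') * k"
    proof -
      define c s where "c = (of_real (gcos v \<tau>) :: complex)" and "s = (of_real (gsin v \<tau>) :: complex)"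
      have cs: "c * c + of_real v * (s * s) = 1"
        using arg_cong[OF gcos_gsin_pythagoras[OF v(1), of \<tau>], of "of_real :: real \<Rightarrow> complex"]
        by (simp add: c_def s_def)
      have w2: "w2 = (w * c - of_real v * s) / D"
        by (simp add: w2_def riccati_flow_def c_def s_def D_def)
      have "B * D\<^sup>2 = - of_real v * D\<^sup>2 - (w * c - of_real v * s)\<^sup>2"
        using D by (simp add: B_def w2 left_diff_distrib power_divide)
      also have "\<dots> = (- of_real v - w\<^sup>2) * (c * c + of_real v * (s * s))"
        by (simp add: D_def c_def[symmetric] s_def[symmetric] power2_eq_square algebra_simps)
      finally have "B * D\<^sup>2 = - of_real v - w\<^sup>2"
        by (simp only: cs mult_1_right)
      then have "B = (- of_real v - w\<^sup>2) * k"
        using D by (simp add: k_def field_simps)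
      show ?thesis
        unfolding \<open>B = (- of_real v - w\<^sup>2) * k\<close> by (simp add: algebra_simps)
    qed
    have e3: "- of_real v' - w2\<^sup>2 = B + of_real (v - v')"
      by (simp add: B_def)
    have "fst (f' (g y)) = (- of_real v' - w2\<^sup>2) * of_real (d3 y)
        + (B * of_real (snd y - d1 y - d3 y) + ((- of_real v' - w\<^sup>2) * k) * of_real (d1 y))"
      by (simp add: f'_def g_def B_def mult_ac)
    also have "\<dots> = B * of_real (snd y) + of_real (v - v') * (of_real (d3 y) + k * of_real (d1 y))"
      unfolding e2 e3 by (simp add: algebra_simps)
    also note e1
    finally show "(f' \<circ> g) y = id y"
      by (simp add: prod_eq_iff) (simp add: f'_def g_def)
  qed
  moreover have "continuous_on UNIV f"
    unfolding f_def
    by (intro continuous_intros continuous_on_riccati_flow v Im_riccati_flow_pos W)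
  ultimately have "f 0 \<in> interior (f ` ball 0 e)"
    using e by (intro sussmann_open_mapping[of UNIV f 0 f' g]) auto
  then obtain r where r: "0 < r" "ball (f 0) r \<subseteq> f ` ball 0 e"
    by (meson mem_interior)
  have f0: "f 0 = (w2, 0)"
    by (simp add: f_def w2_def)
  have "(w2, - r / 2) \<in> ball (f 0) r"
    using r(1) by (simp add: f0 dist_Pair_Pair dist_real_def)
  then obtain z where z: "z \<in> ball 0 e" "f z = (w2, - r / 2)"
    using r(2) by (metis (no_types, lifting) imageE subsetD)
  obtain s1 s2 s3 where s: "z = (s1, s2, s3)"
    by (metis surj_pair)
  have "norm s1 \<le> norm z" "norm s2 \<le> norm (s2, s3)" "norm s3 \<le> norm (s2, s3)" "norm (s2, s3) \<le> norm z"
    unfolding s by (rule norm_fst_le norm_snd_le)+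
  then show thesis
    using that[of s1 s2 s3] z r(1) by (simp add: s f_def w2_def)
qed

context bounded_control
begin

text \<open>The outer segments supply the room for negative variations of their durations.\<close>

lemma fastest_junction:
  assumes x: "fastest a d x" and t: "a < b" "b < c" "c < d"
    and arcs: "const_arc v' a b x" "const_arc v b c x" "const_arc v' c d x"
    and v: "v \<in> {- u1, u2}" "v' \<in> {- u1, u2}" "v \<noteq> v'"
  shows "gsin v (c - b) = 0 \<or> gcos v (c - b) + snd (x b) / fst (x b) * gsin v (c - b) = 0"
proof (rule ccontr)
  assume "\<not> ?thesis"
  then have S: "gsin v (c - b) \<noteq> 0"
    and CS: "gcos v (c - b) + Re (half_plane (x b)) * gsin v (c - b) \<noteq> 0"
    by (simp_all add: half_plane_def)
  have nz: "v \<noteq> 0" "v' \<noteq> 0" using v u1 u2 by auto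
  have pos: "0 < fst (x s)" if "s \<in> {a..d}" for s
    using fastest_pos[OF x that] .
  then have H: "0 < Im (half_plane (x s))" if "s \<in> {a..d}" for s
    using Im_half_plane_pos that by blast
  define e where "e = min (b - a) (min (c - b) (d - c))"
  have "0 < e" using t by (simp add: e_def)
  have Hb: "0 < Im (half_plane (x b))"
    using H[of b] t by simp
  obtain s1 s2 s3 where s: "\<bar>s1\<bar> < e" "\<bar>s2\<bar> < e" "\<bar>s3\<bar> < e" "s1 + s2 + s3 < 0"
    and eq: "riccati_flow v' s3 (riccati_flow v (c - b + s2) (riccati_flow v' s1 (half_plane (x b))))
      = riccati_flow v (c - b) (half_plane (x b))"
    by (rule riccati_flow_shortcut[OF nz v(3) Hb S CS \<open>0 < e\<close>])
  define y1 where "y1 = riccati_flow v' s1 (half_plane (x b))"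
  define y2 where "y2 = riccati_flow v (c - b + s2) y1"
  have y1: "0 < Im y1"
    unfolding y1_def by (rule Im_riccati_flow_pos[OF nz(2) Hb])
  have y2: "0 < Im y2"
    unfolding y2_def by (rule Im_riccati_flow_pos[OF nz(1) y1])
  have "half_plane (x b) = riccati_flow v' (b - a) (half_plane (x a))"
    using const_arc_eq_riccati_flow[OF arcs(1) nz(2), of b] t by simp
  then have "riccati_flow v' (s1 + (b - a)) (half_plane (x a)) = y1"
    using riccati_flow_add[OF nz(2) H[of a], of s1 "b - a"] t by (simp add: y1_def)
  moreover have "0 \<le> s1 + (b - a)" and nonneg: "0 \<le> c - b + s2" "0 \<le> d - c + s3"
    using s(1-3) unfolding e_def by linarith+
  ultimately have 1: "reach (s1 + (b - a)) (x a) (of_half_plane y1)"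
    using reach_riccati_flow[OF v(2) H[of a], of "s1 + (b - a)"] s t pos[of a] by (simp add: e_def)
  have 2: "reach (c - b + s2) (of_half_plane y1) (of_half_plane y2)"
    unfolding y2_def by (intro reach_riccati_flow v y1 nonneg)
  have "half_plane (x c) = riccati_flow v' s3 y2"
    using const_arc_eq_riccati_flow[OF arcs(2) nz(1), of c] eq t by (simp add: y1_def y2_def)
  moreover have "half_plane (x d) = riccati_flow v' (d - c) (half_plane (x c))"
    using const_arc_eq_riccati_flow[OF arcs(3) nz(2), of d] t by simp
  ultimately have "riccati_flow v' (d - c + s3) y2 = half_plane (x d)"
    using riccati_flow_add[OF nz(2) y2, of "d - c" s3] by simp
  then have "reach (d - c + s3) (of_half_plane y2) (x d)"
    using reach_riccati_flow[OF v(2) y2 nonneg(2)] t pos[of d] by simp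
  with 1 2 have "reach (s1 + (b - a) + (c - b + s2) + (d - c + s3)) (x a) (x d)"
    using reach_trans by blast
  with fastest_le[OF x] s(4) show False by fastforce
qed

text \<open>If \<open>gcos v \<tau> + Re w * gsin v \<tau>\<close> vanishes, the denominator of the flow is purely imaginary: the
  oscillator has turned by an odd multiple of a right angle.  The orbits are circular arcs centred on the imaginary axis,
  and the two end points of a quarter turn are antipodal.\<close>

lemma riccati_flow_quarter_turn:
  assumes x: "const_arc v b c x" and v: "v \<noteq> 0" and "b \<le> c"
    and quarter: "gcos v (c - b) + snd (x b) / fst (x b) * gsin v (c - b) = 0"
  shows "snd (x c) / fst (x c) = - (snd (x b) / fst (x b))"
    and "1 / ((fst (x b))\<^sup>2 * (fst (x c))\<^sup>2) = (snd (x b) / fst (x b))\<^sup>2 + v"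
proof -
  define C S where "C = gcos v (c - b)" and "S = gsin v (c - b)"
  define p q where "p = snd (x b) / fst (x b)" and "q = 1 / (fst (x b))\<^sup>2"
  have q: "0 < q"
    using trajectory_on_state_space[OF x, of b] assms(3) by (simp add: q_def)
  have C: "C = - p * S"
    using quarter by (simp add: C_def S_def p_def)
  have "C * C + v * (S * S) = 1"
    using gcos_gsin_pythagoras[OF v] by (simp add: C_def S_def)
  then have S: "S \<noteq> 0" by (auto simp: C)
  have b: "half_plane (x b) = Complex p q"
    by (simp add: half_plane_def p_def q_def)
  have D: "of_real C + Complex p q * of_real S = Complex 0 (q * S)"
    by (simp add: complex_eq_iff C)
  have N: "Complex p q * of_real C - of_real (v * S) = Complex (- (p * p + v) * S) (- p * q * S)"
    by (simp add: complex_eq_iff C algebra_simps)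
  have "half_plane (x c) = Complex (- (p * p + v) * S) (- p * q * S) / Complex 0 (q * S)"
    using const_arc_eq_riccati_flow[OF x v, of c] assms(3)
    by (simp only: riccati_flow_def C_def[symmetric] S_def[symmetric] b D N) simp
  also have "\<dots> = Complex (- p) ((p * p + v) / q)"
    using S q by (simp add: complex_eq_iff Re_divide Im_divide field_simps power2_eq_square)
  finally have "snd (x c) / fst (x c) = - p" "1 / (fst (x c))\<^sup>2 = (p * p + v) / q"
    by (simp_all add: half_plane_def complex_eq_iff)
  moreover from this(2) have "q * (1 / (fst (x c))\<^sup>2) = p\<^sup>2 + v"
    using q by (simp add: power2_eq_square)
  moreover have "1 / ((fst (x b))\<^sup>2 * (fst (x c))\<^sup>2) = q * (1 / (fst (x c))\<^sup>2)"
    by (simp add: q_def)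
  ultimately show "snd (x c) / fst (x c) = - (snd (x b) / fst (x b))"
    "1 / ((fst (x b))\<^sup>2 * (fst (x c))\<^sup>2) = (snd (x b) / fst (x b))\<^sup>2 + v"
    unfolding p_def[symmetric] by simp_all
qed

end

section \<open>Energy along a rightward motion\<close>

lemma compact_sublevel:
  fixes f :: "real \<Rightarrow> real"
  assumes "continuous_on {a..b} f"
  shows "compact {t \<in> {a..b}. f t \<le> c}"
proof -
  have "closed ({a..b} \<inter> f -` {..c})"
    by (rule continuous_closed_preimage[OF assms]) auto
  then have "compact ({a..b} \<inter> ({a..b} \<inter> f -` {..c}))"
    by (rule compact_Int_closed[OF compact_Icc])
  moreover have "{a..b} \<inter> ({a..b} \<inter> f -` {..c}) = {t \<in> {a..b}. f t \<le> c}"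
    by auto
  ultimately show ?thesis by simp
qed

text \<open>A control that is only measurable leaves \<open>x2\<close> without a derivative at some times; one-sided slope bounds
  replace it in the monotonicity argument below.\<close>

lemma nonincreasing_if_upper_slopes_nonpos:
  fixes f :: "real \<Rightarrow> real"
  assumes "a \<le> b" and cont: "continuous_on {a..b} f"
    and slope: "\<And>t e. a \<le> t \<Longrightarrow> t < b \<Longrightarrow> 0 < e \<Longrightarrow>
      \<exists>d>0. \<forall>s. t < s \<and> s < t + d \<and> s \<le> b \<longrightarrow> f s \<le> f t + e * (s - t)"
  shows "f b \<le> f a"
proof -
  have *: "f b \<le> f a + e * (b - a)" if e: "0 < e" for e
  proof -
    define A where "A = {t \<in> {a..b}. f t - e * (t - a) \<le> f a}"
    have "compact A"
      unfolding A_def by (intro compact_sublevel continuous_intros cont)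
    moreover have "a \<in> A" using assms(1) by (simp add: A_def)
    ultimately obtain c where c: "c \<in> A" "\<And>t. t \<in> A \<Longrightarrow> t \<le> c"
      using compact_attains_sup[of A] by blast
    have "c = b"
    proof (rule ccontr)
      assume "c \<noteq> b"
      then have "a \<le> c" "c < b" using c(1) by (auto simp: A_def)
      then obtain d where d: "0 < d" "\<And>s. c < s \<Longrightarrow> s < c + d \<Longrightarrow> s \<le> b \<Longrightarrow> f s \<le> f c + e * (s - c)"
        using slope[OF _ _ e] by blast
      define s where "s = min b (c + d / 2)"
      have s: "c < s" "s < c + d" "s \<le> b" using d \<open>c < b\<close> by (auto simp: s_def)
      with d(2)[OF s] c(1) have "s \<in> A" by (auto simp: A_def algebra_simps)
      with c(2) s(1) show False by force
    qed
    with c(1) show ?thesis by (simp add: A_def)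
  qed
  show ?thesis
  proof (cases "a = b")
    case False
    with assms(1) have "0 < b - a" by simp
    show ?thesis
    proof (rule field_le_epsilon)
      fix e :: real assume "0 < e"
      then show "f b \<le> f a + e"
        using *[of "e / (b - a)"] \<open>0 < b - a\<close> by simp
    qed
  qed simp
qed

text \<open>Formally the energy for \<open>v\<close> has derivative \<open>2 (v - u) x1 x2\<close> under the control \<open>u\<close>.  In the proof
  the increment of \<open>x2\<close> is compared with that of the primitive \<open>P\<close> of the acceleration under the
  constant control \<open>v\<close>, which is differentiable.  The sign \<open>\<sigma>\<close> covers controls above and below \<open>v\<close>
  together.\<close>
lemma energy_monotone:
  assumes x: "trajectory_on a b u x" and "a \<le> b" and \<sigma>: "\<sigma> = 1 \<or> \<sigma> = - 1"
    and u: "\<And>t. t \<in> {a..b} \<Longrightarrow> 0 \<le> \<sigma> * (u t - v)"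
    and right: "\<And>t. t \<in> {a..b} \<Longrightarrow> 0 \<le> snd (x t)"
  shows "\<sigma> * energy v (x b) \<le> \<sigma> * energy v (x a)"
proof (rule nonincreasing_if_upper_slopes_nonpos[OF assms(2)])
  have pos: "0 < fst (x t)" if "t \<in> {a..b}" for t
    using trajectory_on_state_space[OF x that] .
  then have nz: "fst (x t) \<noteq> 0" if "t \<in> {a..b}" for t
    using that by force
  have cx: "continuous_on {a..b} x"
    by (rule trajectory_on_continuous[OF x])
  show "continuous_on {a..b} (\<lambda>t. \<sigma> * energy v (x t))"
    unfolding energy_def by (intro continuous_intros cx) (use nz in auto)
  define F where "F t = - v * fst (x t) + 1 / fst (x t) ^ 3" for t
  define P where "P t = integral {a..t} F" for t
  define \<phi> where "\<phi> t = v * (fst (x t))\<^sup>2 + 1 / (fst (x t))\<^sup>2" for t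
  have cF: "continuous_on {a..b} F"
    unfolding F_def by (intro continuous_intros cx) (use nz in auto)
  fix t e :: real assume t: "a \<le> t" "t < b" and e: "0 < e"
  define U where "U s = \<sigma> * ((P s - P t) * (snd (x s) + snd (x t)) + (\<phi> s - \<phi> t))" for s
  have "(P has_real_derivative F t) (at t within {a..b})"
    unfolding P_def has_real_derivative_iff_has_vector_derivative
    by (rule integral_has_vector_derivative[OF cF]) (use t in simp)
  then have limP: "((\<lambda>s. (P s - P t) / (s - t)) \<longlongrightarrow> F t) (at t within {a..b})"
    by (simp add: has_field_derivative_iff)
  have "(\<phi> has_real_derivative - 2 * F t * snd (x t)) (at t within {a..b})"
    unfolding \<phi>_def using t pos[of t]
    by (auto intro!: derivative_eq_intros trajectory_on_fst_derivative[OF x] simp: F_def)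
       (simp add: field_simps power2_eq_square power3_eq_cube power4_eq_xxxx)
  then have lim\<phi>: "((\<lambda>s. (\<phi> s - \<phi> t) / (s - t)) \<longlongrightarrow> - 2 * F t * snd (x t)) (at t within {a..b})"
    by (simp add: has_field_derivative_iff)
  have "(x \<longlongrightarrow> x t) (at t within {a..b})"
    using cx t by (simp add: continuous_on_def)
  then have limx: "((\<lambda>s. snd (x s)) \<longlongrightarrow> snd (x t)) (at t within {a..b})"
    by (intro tendsto_intros)
  have "((\<lambda>s. \<sigma> * ((P s - P t) / (s - t) * (snd (x s) + snd (x t)) + (\<phi> s - \<phi> t) / (s - t)))
      \<longlongrightarrow> \<sigma> * (F t * (snd (x t) + snd (x t)) + - 2 * F t * snd (x t))) (at t within {a..b})"
    by (intro tendsto_intros limP lim\<phi> limx)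
  moreover have "\<sigma> * ((P s - P t) / (s - t) * (snd (x s) + snd (x t)) + (\<phi> s - \<phi> t) / (s - t))
      = U s / (s - t)" for s
    unfolding U_def by (simp add: add_divide_distrib[symmetric])
  moreover have "\<sigma> * (F t * (snd (x t) + snd (x t)) + - 2 * F t * snd (x t)) = 0"
    by (simp add: algebra_simps)
  ultimately have "((\<lambda>s. U s / (s - t)) \<longlongrightarrow> 0) (at t within {a..b})"
    by simp
  then have "\<forall>\<^sub>F s in at t within {a..b}. U s / (s - t) < e"
    using e by (rule order_tendstoD(2))
  then obtain d where d: "0 < d"
    "\<And>s. s \<in> {a..b} \<Longrightarrow> s \<noteq> t \<Longrightarrow> dist s t < d \<Longrightarrow> U s / (s - t) < e"
    unfolding eventually_at by blast
  show "\<exists>d>0. \<forall>s. t < s \<and> s < t + d \<and> s \<le> b \<longrightarrow>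
      \<sigma> * energy v (x s) \<le> \<sigma> * energy v (x t) + e * (s - t)"
  proof (intro exI[of _ d] conjI allI impI d(1))
    fix s assume s: "t < s \<and> s < t + d \<and> s \<le> b"
    have "U s \<le> e * (s - t)"
      using d(2)[of s] s t by (simp add: dist_real_def divide_less_eq)
    moreover have "\<sigma> * energy v (x s) - \<sigma> * energy v (x t) \<le> U s"
    proof -
      have "((\<lambda>r. \<sigma> * (- u r * fst (x r) + 1 / fst (x r) ^ 3)) has_integral
          \<sigma> * (snd (x s) - snd (x t))) {t..s}"
        using s t by (intro has_integral_mult_right trajectory_on_snd_has_integral[OF x]) auto
      moreover have "(F has_integral (P s - P t)) {t..s}"
      proof -
        have int: "F integrable_on {a..s}"
          using s t by (intro integrable_continuous_real continuous_on_subset[OF cF]) auto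
        have "F integrable_on {t..s}"
          using s t by (intro integrable_continuous_real continuous_on_subset[OF cF]) auto
        moreover have "P t + integral {t..s} F = P s"
          unfolding P_def using s t by (intro Henstock_Kurzweil_Integration.integral_combine int) auto
        ultimately show ?thesis
          by (metis add_diff_cancel_left' integrable_integral)
      qed
      then have "((\<lambda>r. \<sigma> * F r) has_integral \<sigma> * (P s - P t)) {t..s}"
        by (rule has_integral_mult_right)
      ultimately have "\<sigma> * (snd (x s) - snd (x t)) \<le> \<sigma> * (P s - P t)"
      proof (rule has_integral_le)
        fix r assume r: "r \<in> {t..s}"
        have "0 \<le> \<sigma> * (u r - v) * fst (x r)"
          using u[of r] pos[of r] r s t by simp
        then show "\<sigma> * (- u r * fst (x r) + 1 / fst (x r) ^ 3) \<le> \<sigma> * F r"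
          by (simp add: F_def algebra_simps)
      qed
      moreover have "0 \<le> snd (x s) + snd (x t)"
        using right s t by (intro add_nonneg_nonneg) auto
      ultimately have "\<sigma> * (snd (x s) - snd (x t)) * (snd (x s) + snd (x t))
          \<le> \<sigma> * (P s - P t) * (snd (x s) + snd (x t))"
        by (rule mult_right_mono)
      then show ?thesis
        by (simp add: U_def energy_def \<phi>_def power2_eq_square algebra_simps)
    qed
    ultimately show "\<sigma> * energy v (x s) \<le> \<sigma> * energy v (x t) + e * (s - t)"
      by simp
  qed
qed

lemma last_zero_before:
  fixes f :: "real \<Rightarrow> real"
  assumes "continuous_on {a..b} f" "f a = 0" "0 < f b" "a \<le> b"
  obtains z where "a \<le> z" "z < b" "f z = 0" "\<And>t. z < t \<Longrightarrow> t \<le> b \<Longrightarrow> 0 < f t"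
proof -
  define A where "A = {t \<in> {a..b}. f t \<le> 0}"
  have "compact A"
    unfolding A_def by (rule compact_sublevel[OF assms(1)])
  moreover have "a \<in> A" using assms by (simp add: A_def)
  ultimately obtain z where z: "z \<in> A" "\<And>t. t \<in> A \<Longrightarrow> t \<le> z"
    using compact_attains_sup[of A] by blast
  have zb: "a \<le> z" "z < b" using z(1) assms(3) by (auto simp: A_def less_le)
  have pos: "0 < f t" if "z < t" "t \<le> b" for t
    using z(2)[of t] that zb by (force simp: A_def)
  have "f z = 0"
  proof (rule ccontr)
    assume "f z \<noteq> 0"
    then have "f z < 0" using z(1) by (auto simp: A_def)
    then obtain t where "z \<le> t" "t \<le> b" "f t = 0"
      using IVT'[of f z 0 b] assms(1,3) zb
      by (meson atLeastatMost_subset_iff continuous_on_subset less_imp_le order_refl)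
    with pos[of t] \<open>f z \<noteq> 0\<close> show False by (cases "t = z") auto
  qed
  with zb pos that show thesis by blast
qed

lemma first_zero_after:
  fixes f :: "real \<Rightarrow> real"
  assumes "continuous_on {a..b} f" "f b = 0" "0 < f a" "a \<le> b"
  obtains z where "a < z" "z \<le> b" "f z = 0" "\<And>t. a \<le> t \<Longrightarrow> t < z \<Longrightarrow> 0 < f t"
proof -
  have "continuous_on {- b..- a} (\<lambda>t. f (- t))"
    by (rule continuous_on_compose2[OF assms(1)]) (auto intro!: continuous_intros)
  then obtain z where z: "- b \<le> z" "z < - a" "f (- z) = 0" "\<And>t. z < t \<Longrightarrow> t \<le> - a \<Longrightarrow> 0 < f (- t)"
    using last_zero_before[of "- b" "- a" "\<lambda>t. f (- t)"] assms by auto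
  have "0 < f t" if "a \<le> t" "t < - z" for t
    using z(4)[of "- t"] that by simp
  with z that[of "- z"] show thesis by force
qed

section \<open>The arc XY between two rest points\<close>

definition rest_arc :: "real \<Rightarrow> real \<Rightarrow> real \<Rightarrow> real \<times> real" where
  "rest_arc v a t = of_half_plane (riccati_flow v t (Complex 0 (1 / a\<^sup>2)))"

lemma rest_arc:
  assumes v: "v \<noteq> 0" and a: "0 < a"
  shows const_arc_rest_arc: "b \<le> c \<Longrightarrow> const_arc v b c (\<lambda>t. rest_arc v a (t - d))"
    and rest_arc_0: "rest_arc v a 0 = (a, 0)"
    and rest_arc_fst: "0 < fst (rest_arc v a t)"
      "(fst (rest_arc v a t))\<^sup>2 = a\<^sup>2 * (gcos v t)\<^sup>2 + (gsin v t)\<^sup>2 / a\<^sup>2"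
    and rest_arc_snd_pos: "0 < gcos v t * (gsin v t * (1 / a ^ 4 - v)) \<Longrightarrow> 0 < snd (rest_arc v a t)"
    and rest_arc_energy: "energy v (rest_arc v a t) = energy v (a, 0)"
proof -
  have W: "0 < Im (Complex 0 (1 / a\<^sup>2))" using a by simp
  show arc: "const_arc v b c (\<lambda>t. rest_arc v a (t - d))" if "b \<le> c" for b c d
    unfolding rest_arc_def by (rule const_arc_riccati_flow[OF v W that])
  show 0: "rest_arc v a 0 = (a, 0)"
    using a by (simp add: rest_arc_def of_half_plane_def real_sqrt_divide)
  define D where "D = of_real (gcos v t) + Complex 0 (1 / a\<^sup>2) * of_real (gsin v t)"
  define n where "n = (cmod D)\<^sup>2"
  have D: "D \<noteq> 0"
    unfolding D_def by (rule riccati_denominator_nonzero[OF v W])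
  have n: "n = (gcos v t)\<^sup>2 + (gsin v t)\<^sup>2 / a ^ 4" "0 < n"
    using D by (simp_all add: n_def) (simp add: D_def cmod_power2 power_divide flip: power_mult)
  have I: "Im (riccati_flow v t (Complex 0 (1 / a\<^sup>2))) = 1 / (a\<^sup>2 * n)"
    using Im_riccati_flow[OF v W, of t] by (simp add: D_def n_def)
  show pos: "0 < fst (rest_arc v a t)"
    using I a n(2) by (simp add: rest_arc_def of_half_plane_def)
  have "a\<^sup>2 * ((gsin v t)\<^sup>2 / a ^ 4) = (gsin v t)\<^sup>2 / a\<^sup>2"
    using a by (simp add: field_simps power4_eq_xxxx power2_eq_square)
  moreover have "(fst (rest_arc v a t))\<^sup>2 = a\<^sup>2 * n"
    using I a n(2) by (simp add: rest_arc_def of_half_plane_def power_divide)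
  ultimately show "(fst (rest_arc v a t))\<^sup>2 = a\<^sup>2 * (gcos v t)\<^sup>2 + (gsin v t)\<^sup>2 / a\<^sup>2"
    by (simp add: n(1) distrib_left)
  have "Re (riccati_flow v t (Complex 0 (1 / a\<^sup>2))) = gcos v t * (gsin v t * (1 / a ^ 4 - v)) / n"
    unfolding riccati_flow_def D_def[symmetric] Re_divide n_def cmod_power2
    by (simp add: D_def field_simps power4_eq_xxxx power2_eq_square)
  then show "0 < snd (rest_arc v a t)" if "0 < gcos v t * (gsin v t * (1 / a ^ 4 - v))"
    using that n(2) I a by (simp add: rest_arc_def of_half_plane_def)
  show "energy v (rest_arc v a t) = energy v (a, 0)"
    using const_arc_energy[OF arc[of "min 0 t" "max 0 t" 0], of t 0] 0 by simp
qed

lemma gcos_square: "v \<noteq> 0 \<Longrightarrow> (gcos v t)\<^sup>2 = 1 - v * (gsin v t)\<^sup>2"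
  using gcos_gsin_pythagoras[of v t] by (simp add: power2_eq_square)

text \<open>Along an X-trajectory from rest, \<open>x1\<^sup>2\<close> is an affine function of the square of a hyperbolic sine
  and so takes every larger value.\<close>

lemma rest_arc_outward:
  assumes "v < 0" "0 < a" "a\<^sup>2 \<le> r"
  obtains t where "0 \<le> t" "(fst (rest_arc v a t))\<^sup>2 = r" "\<And>s. 0 < s \<Longrightarrow> 0 < snd (rest_arc v a s)"
proof -
  define k where "k = sqrt (- v)"
  have k: "0 < k" "v = - (k * k)"
    using assms(1) sqrt_mult_self_minus[of v] by (simp_all add: k_def)
  define m where "m = k\<^sup>2 * a\<^sup>2 + 1 / a\<^sup>2"
  have m: "0 < m" using k(1) assms(2) by (simp add: m_def add_pos_pos)
  \<comment> \<open>The position is \<open>x1\<^sup>2 = a\<^sup>2 + m * (gsin v t)\<^sup>2\<close>, which is solved for \<open>t\<close>.\<close>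
  define t where "t = arsinh (k * sqrt ((r - a\<^sup>2) / m)) / k"
  have "gsin v t = sqrt ((r - a\<^sup>2) / m)"
    using k(1) assms(1) by (simp add: gsin_def k_def[symmetric] t_def)
  then have S: "(gsin v t)\<^sup>2 = (r - a\<^sup>2) / m"
    using assms(3) m by simp
  have mv: "m = - v * a\<^sup>2 + 1 / a\<^sup>2"
    by (simp add: m_def k(2) power2_eq_square)
  have "(fst (rest_arc v a t))\<^sup>2 = a\<^sup>2 + m * (gsin v t)\<^sup>2"
    using assms(1,2) by (simp add: rest_arc_fst gcos_square mv algebra_simps)
  also have "\<dots> = r" using m by (simp add: S)
  finally have "(fst (rest_arc v a t))\<^sup>2 = r" .
  moreover have "0 \<le> arsinh z" if "0 \<le> z" for z :: real
    using that arsinh_real_pos_iff[of z] by (metis arsinh_0 less_eq_real_def)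
  then have "0 \<le> arsinh (k * sqrt ((r - a\<^sup>2) / m))"
    using k(1) assms(3) m by simp
  then have "0 \<le> t"
    using k(1) by (simp add: t_def)
  moreover have "0 < snd (rest_arc v a s)" if "0 < s" for s
  proof (rule rest_arc_snd_pos)
    have "0 < gcos v s" "0 < gsin v s"
      using assms(1) k(1) that by (simp_all add: gcos_def gsin_def k_def[symmetric] cosh_real_pos)
    moreover have "0 < 1 / a ^ 4 - v"
      using assms(1,2) by (simp add: add_pos_pos diff_conv_add_uminus del: add_uminus_conv_diff)
    ultimately show "0 < gcos v s * (gsin v s * (1 / a ^ 4 - v))"
      by (intro mult_pos_pos)
  qed (use assms in auto)
  ultimately show thesis using that by blast
qed

text \<open>A Y-trajectory arriving at rest in \<open>b\<close> from the left has started, half a period earlier, at rest in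
  \<open>1 / (sqrt v * b)\<close>; so on the way it passes all positions between these two, which are the ones with
  \<open>1 / (v * b\<^sup>2) \<le> x1\<^sup>2 \<le> b\<^sup>2\<close>.\<close>

lemma rest_arc_inward:
  assumes "0 < v" "0 < b" "r < b\<^sup>2" "1 \<le> v * (r * b\<^sup>2)"
  obtains t where "0 < t" "(fst (rest_arc v b (- t)))\<^sup>2 = r"
    "\<And>s. - t < s \<Longrightarrow> s < 0 \<Longrightarrow> 0 < snd (rest_arc v b s)"
proof -
  define k where "k = sqrt v"
  have k: "0 < k" "k\<^sup>2 = v"
    using assms(1) by (simp_all add: k_def)
  have "1 \<le> v * r * b\<^sup>2"
    using assms(4) by (simp add: mult.assoc)
  then have vr: "1 / b\<^sup>2 \<le> v * r"
    using assms(2) by (simp add: pos_divide_le_eq)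
  define m where "m = v * b\<^sup>2 - 1 / b\<^sup>2"
  have "v * r < v * b\<^sup>2" using assms by simp
  with vr have m: "0 < m" by (simp add: m_def)
  \<comment> \<open>The position is \<open>x1\<^sup>2 = b\<^sup>2 - m * (gsin v t)\<^sup>2\<close>, and \<open>z\<close> is the sine to be attained.\<close>
  define z where "z = k * sqrt ((b\<^sup>2 - r) / m)"
  have z0: "0 < z" using k(1) assms(3) m by (simp add: z_def)
  have "z\<^sup>2 = v * ((b\<^sup>2 - r) / m)"
    using k assms(3) m by (simp add: z_def power_mult_distrib)
  also have "\<dots> \<le> 1"
    using m vr by (simp add: divide_le_eq m_def algebra_simps)
  finally have z1: "z \<le> 1"
    using abs_square_le_1[of z] by simp
  define t where "t = arcsin z / k"
  have ar: "0 < arcsin z" "arcsin z \<le> pi / 2"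
    using z0 z1 arcsin_less_mono[of 0 z] arcsin_bounded[of z] by simp_all
  have t: "0 < t" "k * t \<le> pi / 2"
    using ar k(1) by (simp_all add: t_def)
  have "gsin v t = sqrt ((b\<^sup>2 - r) / m)"
    using k(1) z0 z1 assms(1) by (simp add: gsin_def k_def[symmetric] t_def z_def)
  then have S: "(gsin v t)\<^sup>2 = (b\<^sup>2 - r) / m"
    using assms(3) m by simp
  have "(fst (rest_arc v b (- t)))\<^sup>2 = b\<^sup>2 - m * (gsin v t)\<^sup>2"
    using assms(1,2) by (simp add: rest_arc_fst gcos_square m_def algebra_simps)
  also have "\<dots> = r" using m by (simp add: S)
  finally have "(fst (rest_arc v b (- t)))\<^sup>2 = r" .
  moreover have "0 < snd (rest_arc v b s)" if s: "- t < s" "s < 0" for s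
  proof (rule rest_arc_snd_pos)
    have "k * (- s) < k * t" using s k(1) by (intro mult_strict_left_mono) auto
    then have ks: "- (pi / 2) < k * s" "k * s < 0"
      using t(2) s k(1) by (simp_all add: mult_pos_neg)
    have "0 < cos (k * s)"
      using ks by (intro cos_gt_zero_pi) (auto intro: less_trans)
    moreover have "sin (k * s) < 0"
      using ks by (intro sin_less_zero) simp_all
    ultimately have "0 < gcos v s" "gsin v s < 0"
      using assms(1) k(1) by (simp_all add: gcos_def gsin_def k_def[symmetric] divide_neg_pos)
    moreover have "1 / b ^ 4 - v < 0"
      using m assms(2) by (simp add: m_def field_simps power4_eq_xxxx power2_eq_square)
    ultimately show "0 < gcos v s * (gsin v s * (1 / b ^ 4 - v))"
      by (intro mult_pos_pos mult_neg_neg)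
  qed (use assms in auto)
  ultimately show thesis using that t(1) by blast
qed

context bounded_control
begin

text \<open>The switching takes place where the X-trajectory from \<open>a\<close> and the Y-trajectory into \<open>b\<close> meet: their
  energies differ by \<open>(u1 + u2) * x1\<^sup>2\<close> at a common state, which determines \<open>r = x1\<^sup>2\<close>.\<close>

lemma XY_reference:
  assumes a: "0 < a" "a < b" and ab: "1 \<le> u2 * (a\<^sup>2 * b\<^sup>2)"
  obtains \<alpha> \<beta> y where "0 \<le> \<alpha>" "0 < \<beta>" "const_arc (- u1) 0 \<alpha> y" "const_arc u2 \<alpha> (\<alpha> + \<beta>) y"
    "y 0 = (a, 0)" "y (\<alpha> + \<beta>) = (b, 0)" "\<And>t. 0 < t \<Longrightarrow> t < \<alpha> + \<beta> \<Longrightarrow> 0 < snd (y t)"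
proof -
  define r where "r = (energy u2 (b, 0) - energy (- u1) (a, 0)) / (u1 + u2)"
  have U: "0 < u1 + u2" using u1 u2 by simp
  have b: "0 < b" using a by simp
  have sq: "a\<^sup>2 < b\<^sup>2" using a by (simp add: power_strict_mono)
  have ar: "a\<^sup>2 \<le> r"
  proof -
    have "0 \<le> (b\<^sup>2 - a\<^sup>2) * (u2 - 1 / (a\<^sup>2 * b\<^sup>2))"
      using ab sq a b by (intro mult_nonneg_nonneg) (simp_all add: divide_le_eq)
    also have "\<dots> = energy u2 (b, 0) - energy (- u1) (a, 0) - a\<^sup>2 * (u1 + u2)"
      using a b by (simp add: energy_def field_simps)
    finally show ?thesis
      using U by (simp add: r_def pos_le_divide_eq)
  qed
  have rb: "r < b\<^sup>2"
  proof -
    have "0 < (b\<^sup>2 - a\<^sup>2) * (u1 + 1 / (a\<^sup>2 * b\<^sup>2))"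
      using sq a b u1 by (intro mult_pos_pos add_pos_pos) simp_all
    also have "\<dots> = b\<^sup>2 * (u1 + u2) - (energy u2 (b, 0) - energy (- u1) (a, 0))"
      using a b by (simp add: energy_def field_simps)
    finally show ?thesis
      using U by (simp add: r_def pos_divide_less_eq)
  qed
  have "u2 * (a\<^sup>2 * b\<^sup>2) \<le> u2 * (r * b\<^sup>2)"
    using ar u2 by (intro mult_left_mono mult_right_mono) simp_all
  with ab have rb1: "1 \<le> u2 * (r * b\<^sup>2)" by linarith
  have "- u1 < 0" using u1 by simp
  from rest_arc_outward[OF this a(1) ar] obtain \<alpha> where \<alpha>: "0 \<le> \<alpha>"
    "(fst (rest_arc (- u1) a \<alpha>))\<^sup>2 = r" "\<And>s. 0 < s \<Longrightarrow> 0 < snd (rest_arc (- u1) a s)"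
    by blast
  have "0 < u2" using u2 by simp
  from rest_arc_inward[OF this b rb rb1] obtain \<beta> where \<beta>: "0 < \<beta>"
    "(fst (rest_arc u2 b (- \<beta>)))\<^sup>2 = r" "\<And>s. - \<beta> < s \<Longrightarrow> s < 0 \<Longrightarrow> 0 < snd (rest_arc u2 b s)"
    by blast
  have nz: "- u1 \<noteq> 0" "u2 \<noteq> 0" using u1 u2 by auto
  note X = rest_arc[OF nz(1) a(1)] and Y = rest_arc[OF nz(2) b]
  define y where "y t = (if t \<le> \<alpha> then rest_arc (- u1) a t else rest_arc u2 b (t - (\<alpha> + \<beta>)))" for t
  \<comment> \<open>Both velocities at the meeting point are nonnegative and have the same square, so they agree.
    For the Y-arc the sign is obtained as a limit, since the meeting point may be its initial rest.\<close>
  have snd_nonneg: "0 \<le> snd (rest_arc (- u1) a \<alpha>)"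
    using \<alpha>(1) \<alpha>(3)[of \<alpha>] X(2) by (cases "\<alpha> = 0") auto
  have "continuous_on {- \<beta> - 1..- \<beta> + 1} (rest_arc u2 b)"
    using trajectory_on_continuous[OF Y(1)[of "- \<beta> - 1" "- \<beta> + 1" 0]] by simp
  then have "isCont (rest_arc u2 b) (- \<beta>)"
    by (rule continuous_on_interior) (simp add: interior_atLeastAtMost_real)
  then have "(rest_arc u2 b \<longlongrightarrow> rest_arc u2 b (- \<beta>)) (at_right (- \<beta>))"
    unfolding isCont_def by (rule tendsto_mono[OF at_le, rotated]) simp
  then have lim: "((\<lambda>s. snd (rest_arc u2 b s)) \<longlongrightarrow> snd (rest_arc u2 b (- \<beta>))) (at_right (- \<beta>))"
    by (rule tendsto_snd)
  have "0 \<le> snd (rest_arc u2 b (- \<beta>))"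
  proof (rule tendsto_lowerbound[OF lim])
    show "\<forall>\<^sub>F s in at_right (- \<beta>). 0 \<le> snd (rest_arc u2 b s)"
      unfolding eventually_at_right_field using \<beta> by (intro exI[of _ 0]) (auto intro: less_imp_le)
  qed simp
  moreover have "(snd (rest_arc (- u1) a \<alpha>))\<^sup>2 = (snd (rest_arc u2 b (- \<beta>)))\<^sup>2"
  proof -
    have "r * (u1 + u2) = energy u2 (b, 0) - energy (- u1) (a, 0)"
      using U by (simp add: r_def)
    then show ?thesis
      using X(6)[of \<alpha>] Y(6)[of "- \<beta>"] by (simp add: energy_def \<alpha>(2) \<beta>(2) algebra_simps)
  qed
  ultimately have "snd (rest_arc (- u1) a \<alpha>) = snd (rest_arc u2 b (- \<beta>))"
    using snd_nonneg by (simp add: power2_eq_iff_nonneg)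
  moreover have "fst (rest_arc (- u1) a \<alpha>) = fst (rest_arc u2 b (- \<beta>))"
    by (rule power2_eq_imp_eq)
      (use \<alpha>(2) \<beta>(2) X(3)[of \<alpha>] Y(3)[of "- \<beta>"] in simp_all)
  ultimately have match: "rest_arc (- u1) a \<alpha> = rest_arc u2 b (- \<beta>)"
    by (simp add: prod_eq_iff)
  have "const_arc (- u1) 0 \<alpha> y"
    by (rule trajectory_on_cong[OF X(1)[OF \<alpha>(1), of 0]]) (simp_all add: y_def)
  moreover have "const_arc u2 \<alpha> (\<alpha> + \<beta>) y"
    by (rule trajectory_on_cong[OF Y(1)[of \<alpha> "\<alpha> + \<beta>" "\<alpha> + \<beta>"]]) (use \<beta>(1) match in \<open>auto simp: y_def\<close>)
  moreover have "y 0 = (a, 0)" "y (\<alpha> + \<beta>) = (b, 0)"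
    using \<alpha>(1) \<beta>(1) X(2) Y(2) by (simp_all add: y_def)
  moreover have "0 < snd (y t)" if "0 < t" "t < \<alpha> + \<beta>" for t
    using \<alpha>(3)[of t] \<beta>(3)[of "t - (\<alpha> + \<beta>)"] that by (simp add: y_def)
  ultimately show thesis
    using that \<alpha>(1) \<beta>(1) by blast
qed

section \<open>Fastest motion between extreme rest points\<close>

lemma fastest_interior_extremum:
  assumes x: "fastest a b x" and t: "a < t" "t < b"
    and ext: "(\<forall>s\<in>{a..b}. fst (x t) \<le> fst (x s)) \<or> (\<forall>s\<in>{a..b}. fst (x s) \<le> fst (x t))"
  shows "snd (x t) = 0"
proof -
  have d: "((\<lambda>t. fst (x t)) has_real_derivative snd (x t)) (at t)"
    using fastest_fst_derivative[OF x, of t] t at_within_Icc_at[of a t b] by simp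
  have in_ab: "s \<in> {a..b}" if "\<bar>t - s\<bar> < min (t - a) (b - t)" for s
    using that by auto
  have pos: "0 < min (t - a) (b - t)" using t by simp
  from ext show ?thesis
  proof
    assume "\<forall>s\<in>{a..b}. fst (x t) \<le> fst (x s)"
    then show ?thesis
      using in_ab by (intro DERIV_local_min[OF d pos]) blast
  next
    assume "\<forall>s\<in>{a..b}. fst (x s) \<le> fst (x t)"
    then show ?thesis
      using in_ab by (intro DERIV_local_max[OF d pos]) blast
  qed
qed

text \<open>While moving right, the trajectory has come from an earlier rest point at or to the right of \<open>a\<close> and
  goes to a later one at or to the left of \<open>b\<close>.  The energy for \<open>- u1\<close> is at most its value at the
  former, the energy for \<open>u2\<close> at most its value at the latter, and both rest energies are monotone in
  the position where this is needed.\<close>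

lemma confined_energy_bounds:
  assumes x: "fastest s t x" and ends: "x s = (a, 0)" "x t = (b, 0)"
    and conf: "\<And>\<tau>. \<tau> \<in> {s..t} \<Longrightarrow> a \<le> fst (x \<tau>) \<and> fst (x \<tau>) \<le> b"
    and \<tau>: "\<tau> \<in> {s..t}" "0 < snd (x \<tau>)"
  shows "energy (- u1) (x \<tau>) \<le> energy (- u1) (a, 0)" "energy u2 (x \<tau>) \<le> energy u2 (b, 0)"
proof -
  obtain u where u: "\<And>r. r \<in> {s..t} \<Longrightarrow> u r \<in> {- u1..u2}" and tr: "trajectory_on s t u x"
    by (rule fastest_obtain_control[OF x]) blast
  have cont: "continuous_on {s..t} (\<lambda>r. snd (x r))"
    by (intro continuous_intros fastest_continuous[OF x])
  have a: "0 < a" using fastest_pos[OF x, of s] fastestD(1)[OF x] ends by simp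
  show "energy (- u1) (x \<tau>) \<le> energy (- u1) (a, 0)"
  proof -
    obtain z where z: "s \<le> z" "z < \<tau>" "snd (x z) = 0" "\<And>r. z < r \<Longrightarrow> r \<le> \<tau> \<Longrightarrow> 0 < snd (x r)"
      using last_zero_before[of s \<tau> "\<lambda>r. snd (x r)"] continuous_on_subset[OF cont] \<tau> ends by auto
    have "1 * energy (- u1) (x \<tau>) \<le> 1 * energy (- u1) (x z)"
    proof (rule energy_monotone)
      show "trajectory_on z \<tau> u x"
        using trajectory_on_subinterval[OF tr] z \<tau> by auto
      show "0 \<le> snd (x r)" if "r \<in> {z..\<tau>}" for r
        using z(3) z(4)[of r] that by (cases "r = z") auto
      show "0 \<le> 1 * (u r - - u1)" if "r \<in> {z..\<tau>}" for r
        using u[of r] that z \<tau> by auto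
    qed (use z in auto)
    moreover have "energy (- u1) (x z) \<le> energy (- u1) (a, 0)"
    proof -
      have az: "a \<le> fst (x z)" using conf[of z] z \<tau> by auto
      then have "a\<^sup>2 \<le> (fst (x z))\<^sup>2" using a by (intro power_mono) auto
      moreover from this have "1 / (fst (x z))\<^sup>2 \<le> 1 / a\<^sup>2"
        using a az by (intro divide_left_mono mult_pos_pos) auto
      moreover from calculation(1) have "u1 * a\<^sup>2 \<le> u1 * (fst (x z))\<^sup>2"
        using u1 by (intro mult_left_mono) auto
      ultimately show ?thesis
        using z(3) by (simp add: energy_def)
    qed
    ultimately show ?thesis by simp
  qed
  show "energy u2 (x \<tau>) \<le> energy u2 (b, 0)"
  proof -
    obtain z where z: "\<tau> < z" "z \<le> t" "snd (x z) = 0" "\<And>r. \<tau> \<le> r \<Longrightarrow> r < z \<Longrightarrow> 0 < snd (x r)"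
      using first_zero_after[of \<tau> t "\<lambda>r. snd (x r)"] continuous_on_subset[OF cont] \<tau> ends by auto
    have "- 1 * energy u2 (x z) \<le> - 1 * energy u2 (x \<tau>)"
    proof (rule energy_monotone)
      show "trajectory_on \<tau> z u x"
        using trajectory_on_subinterval[OF tr] z \<tau> by auto
      show "0 \<le> snd (x r)" if "r \<in> {\<tau>..z}" for r
        using z(3) z(4)[of r] that by (cases "r = z") auto
      show "0 \<le> - 1 * (u r - u2)" if "r \<in> {\<tau>..z}" for r
        using u[of r] that z \<tau> by auto
    qed (use z in auto)
    then have e: "energy u2 (x \<tau>) \<le> energy u2 (x z)" by simp
    have "fst (x \<tau>) < fst (x z)"
    proof (rule DERIV_pos_imp_increasing_open[OF z(1)])
      show "continuous_on {\<tau>..z} (\<lambda>r. fst (x r))"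
        using z \<tau> by (intro continuous_intros continuous_on_subset[OF fastest_continuous[OF x]]) auto
      fix r assume r: "\<tau> < r" "r < z"
      then have "((\<lambda>t. fst (x t)) has_real_derivative snd (x r)) (at r)"
        using fastest_fst_derivative[OF x, of r] z \<tau> at_within_Icc_at[of s r t] by simp
      then show "\<exists>y. ((\<lambda>t. fst (x t)) has_real_derivative y) (at r) \<and> 0 < y"
        using z(4)[of r] r by auto
    qed
    define p q r where "p = (fst (x \<tau>))\<^sup>2" and "q = (fst (x z))\<^sup>2" and "r = b\<^sup>2"
    have p: "0 < p" "p < q"
      using fastest_pos[OF x \<tau>(1)] \<open>fst (x \<tau>) < fst (x z)\<close>
      by (simp_all add: p_def q_def power_strict_mono)
    have q: "q \<le> r"
      unfolding q_def r_def using conf[of z] fastest_pos[OF x, of z] z \<tau> by (intro power_mono) auto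
    have "(snd (x \<tau>))\<^sup>2 + u2 * p + 1 / p \<le> u2 * q + 1 / q"
      using e z(3) by (simp add: energy_def p_def q_def)
    then have "u2 * p + 1 / p \<le> u2 * q + 1 / q"
      using zero_le_power2[of "snd (x \<tau>)"] by linarith
    then have "0 \<le> (q - p) * (u2 - 1 / (p * q))"
      using p by (simp add: field_simps)
    then have pq: "1 / (p * q) \<le> u2"
      using p by (simp add: zero_le_mult_iff)
    have "1 / (r * q) \<le> 1 / (p * q)"
      using p q by (intro divide_left_mono mult_right_mono) auto
    with pq have "0 \<le> (r - q) * (u2 - 1 / (r * q))"
      using q by (intro mult_nonneg_nonneg) auto
    then have "u2 * q + 1 / q \<le> u2 * r + 1 / r"
      using p q by (simp add: field_simps)
    with e z(3) show ?thesis
      by (simp add: energy_def p_def q_def r_def)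
  qed
qed

text \<open>The first conclusion is the condition for an arc XY from \<open>a\<close> to \<open>b\<close> to exist.  It follows from the
  second energy bound in the limit of times with positive velocity that tend to \<open>s\<close>.\<close>

lemma confined_endpoints:
  assumes x: "fastest s t x" and ends: "x s = (a, 0)" "x t = (b, 0)" "a < b"
    and conf: "\<And>\<tau>. \<tau> \<in> {s..t} \<Longrightarrow> a \<le> fst (x \<tau>) \<and> fst (x \<tau>) \<le> b"
  shows "1 \<le> u2 * (a\<^sup>2 * b\<^sup>2)" "\<And>\<tau>. s < \<tau> \<Longrightarrow> \<tau> < t \<Longrightarrow> a < fst (x \<tau>) \<and> fst (x \<tau>) < b"
proof -
  have st: "s < t" using fastestD(1)[OF x] ends by (cases "s = t") auto
  have a: "0 < a" using fastest_pos[OF x, of s] fastestD(1)[OF x] ends by simp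
  show inner: "a < fst (x \<tau>) \<and> fst (x \<tau>) < b" if \<tau>: "s < \<tau>" "\<tau> < t" for \<tau>
  proof (rule ccontr)
    assume "\<not> (a < fst (x \<tau>) \<and> fst (x \<tau>) < b)"
    with conf[of \<tau>] \<tau> consider "fst (x \<tau>) = a" | "fst (x \<tau>) = b" by force
    then show False
    proof cases
      case 1
      with conf have "snd (x \<tau>) = 0"
        by (intro fastest_interior_extremum[OF x \<tau>]) auto
      with 1 ends have "x \<tau> = x s" by (simp add: prod_eq_iff)
      with fastest_inj[OF x, of \<tau> s] \<tau> show False by auto
    next
      case 2
      with conf have "snd (x \<tau>) = 0"
        by (intro fastest_interior_extremum[OF x \<tau>]) auto
      with 2 ends have "x \<tau> = x t" by (simp add: prod_eq_iff)
      with fastest_inj[OF x, of \<tau> t] \<tau> show False by auto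
    qed
  qed
  have cx: "continuous_on {s..t} x" by (rule fastest_continuous[OF x])
  have nz: "fst (x r) \<noteq> 0" if "r \<in> {s..t}" for r
    using fastest_pos[OF x that] by simp
  have "continuous_on {s..t} (\<lambda>r. energy u2 (x r))"
    unfolding energy_def by (intro continuous_intros cx) (use nz in auto)
  then have lim: "((\<lambda>r. energy u2 (x r)) \<longlongrightarrow> energy u2 (x s)) (at s within {s..t})"
    using st by (simp add: continuous_on_def)
  have "energy u2 (x s) \<le> energy u2 (b, 0)"
  proof (rule ccontr)
    assume "\<not> energy u2 (x s) \<le> energy u2 (b, 0)"
    then have "\<forall>\<^sub>F r in at s within {s..t}. energy u2 (b, 0) < energy u2 (x r)"
      using order_tendstoD(1)[OF lim] by simp
    then obtain d where d: "0 < d"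
      "\<And>r. r \<in> {s..t} \<Longrightarrow> r \<noteq> s \<Longrightarrow> dist r s < d \<Longrightarrow> energy u2 (b, 0) < energy u2 (x r)"
      unfolding eventually_at by blast
    define \<tau> where "\<tau> = min ((s + t) / 2) (s + d / 2)"
    have \<tau>: "s < \<tau>" "\<tau> < t" "\<tau> < s + d"
      using st d(1) by (auto simp: \<tau>_def min_def field_simps)
    have "fst (x \<tau>) \<le> fst (x s)"
    proof (rule DERIV_nonpos_imp_decreasing_open[where f = "\<lambda>r. fst (x r)"])
      show "continuous_on {s..\<tau>} (\<lambda>r. fst (x r))"
        using \<tau> by (intro continuous_intros continuous_on_subset[OF cx]) auto
      fix r assume r: "s < r" "r < \<tau>"
      have "snd (x r) \<le> 0"
      proof (rule ccontr)
        assume "\<not> snd (x r) \<le> 0"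
        then have "energy u2 (x r) \<le> energy u2 (b, 0)"
          using confined_energy_bounds(2)[OF x ends(1,2) conf] r \<tau> by auto
        moreover have "energy u2 (b, 0) < energy u2 (x r)"
          using d(2)[of r] r \<tau> by (simp add: dist_real_def)
        ultimately show False by simp
      qed
      moreover have "((\<lambda>t. fst (x t)) has_real_derivative snd (x r)) (at r)"
        using fastest_fst_derivative[OF x, of r] r \<tau> at_within_Icc_at[of s r t] by simp
      ultimately show "\<exists>y. ((\<lambda>t. fst (x t)) has_real_derivative y) (at r) \<and> y \<le> 0"
        by blast
    qed (use \<tau> in simp)
    with inner[OF \<tau>(1,2)] ends show False by simp
  qed
  then have e: "u2 * a\<^sup>2 + 1 / a\<^sup>2 \<le> u2 * b\<^sup>2 + 1 / b\<^sup>2"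
    by (simp add: energy_def ends)
  have "a\<^sup>2 < b\<^sup>2" using a ends by (simp add: power_strict_mono)
  moreover have "0 \<le> (b\<^sup>2 - a\<^sup>2) * (u2 - 1 / (a\<^sup>2 * b\<^sup>2))"
    using e a ends(3) by (simp add: field_simps)
  ultimately have "1 / (a\<^sup>2 * b\<^sup>2) \<le> u2"
    by (simp add: zero_le_mult_iff)
  then show "1 \<le> u2 * (a\<^sup>2 * b\<^sup>2)"
    using a ends by (simp add: divide_le_eq)
qed

text \<open>Let \<open>\<Theta>\<close> assign to a position the time at which the arc XY from \<open>a\<close> to \<open>b\<close> passes it.  The energy
  bounds say that \<open>x\<close> is never faster than this arc at the same position, so \<open>\<Theta> (x1 \<tau>) - \<tau>\<close> does not
  increase.  Since \<open>x\<close> is not slower in total, it is constant and \<open>x\<close> is the arc.  Inside the interval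
  \<open>x\<close> may a priori come to rest or turn back; only its extreme positions are prescribed.\<close>

lemma fastest_confined_right:
  assumes x: "fastest s t x" and ends: "x s = (a, 0)" "x t = (b, 0)" "a < b"
    and conf: "\<And>\<tau>. \<tau> \<in> {s..t} \<Longrightarrow> a \<le> fst (x \<tau>) \<and> fst (x \<tau>) \<le> b"
  obtains \<sigma> where "s \<le> \<sigma>" "\<sigma> < t" "const_arc (- u1) s \<sigma> x" "const_arc u2 \<sigma> t x"
    "\<And>\<tau>. s < \<tau> \<Longrightarrow> \<tau> < t \<Longrightarrow> 0 < snd (x \<tau>)"
proof -
  have st: "s < t" using fastestD(1)[OF x] ends by (cases "s = t") auto
  have a: "0 < a" using fastest_pos[OF x, of s] fastestD(1)[OF x] ends by simp
  have ce1: "1 \<le> u2 * (a\<^sup>2 * b\<^sup>2)"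
    using conf by (rule confined_endpoints[OF x ends])
  have ce2: "a < fst (x \<tau>) \<and> fst (x \<tau>) < b" if "s < \<tau>" "\<tau> < t" for \<tau>
    using conf that by (rule confined_endpoints[OF x ends])
  obtain \<alpha> \<beta> y where \<alpha>\<beta>: "0 \<le> \<alpha>" "0 < \<beta>"
    and yX: "const_arc (- u1) 0 \<alpha> y" and yY: "const_arc u2 \<alpha> (\<alpha> + \<beta>) y"
    and y_ends: "y 0 = (a, 0)" "y (\<alpha> + \<beta>) = (b, 0)"
    and y_pos: "\<And>\<theta>. 0 < \<theta> \<Longrightarrow> \<theta> < \<alpha> + \<beta> \<Longrightarrow> 0 < snd (y \<theta>)"
    by (rule XY_reference[OF a ends(3) ce1]) (rule that)
  define D where "D = \<alpha> + \<beta>"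
  have D: "0 < D" using \<alpha>\<beta> by (simp add: D_def)
  have y_nonneg: "0 \<le> snd (y \<theta>)" if "\<theta> \<in> {0..D}" for \<theta>
    using that y_ends y_pos[of \<theta>] by (cases "\<theta> = 0 \<or> \<theta> = D") (auto simp: D_def)
  have tr_y: "trajectory_on 0 D (\<lambda>\<theta>. if \<theta> \<le> \<alpha> then - u1 else u2) y"
    unfolding D_def using \<alpha>\<beta> by (intro trajectory_on_concat yX yY) auto
  have "reach \<alpha> (a, 0) (y \<alpha>)" "reach \<beta> (y \<alpha>) (b, 0)"
    using admissible_arc_imp_reach[OF admissible_arc_const[OF yX]]
      admissible_arc_imp_reach[OF admissible_arc_const[OF yY]] \<alpha>\<beta> y_ends by auto
  then have "reach D (x s) (x t)"
    unfolding D_def ends by (rule reach_trans)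
  then have tD: "t - s \<le> D"
    by (rule fastest_le[OF x])
  have slower: "snd (x \<tau>) \<le> snd (y \<theta>)"
    if \<tau>: "\<tau> \<in> {s..t}" and \<theta>: "\<theta> \<in> {0..D}" and same: "fst (x \<tau>) = fst (y \<theta>)" for \<tau> \<theta>
  proof (cases "0 < snd (x \<tau>)")
    case True
    have eb: "energy (- u1) (x \<tau>) \<le> energy (- u1) (a, 0)" "energy u2 (x \<tau>) \<le> energy u2 (b, 0)"
      using confined_energy_bounds[OF x ends(1,2) _ \<tau> True] conf by blast+
    have "(snd (x \<tau>))\<^sup>2 \<le> (snd (y \<theta>))\<^sup>2"
    proof (cases "\<theta> \<le> \<alpha>")
      case True
      then have "energy (- u1) (y \<theta>) = energy (- u1) (a, 0)"
        using const_arc_energy[OF yX, of \<theta> 0] \<theta> \<alpha>\<beta> y_ends by simp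
      with eb(1) same show ?thesis by (simp add: energy_def)
    next
      case False
      then have "energy u2 (y \<theta>) = energy u2 (b, 0)"
        using const_arc_energy[OF yY, of \<theta> "\<alpha> + \<beta>"] \<theta> \<alpha>\<beta> y_ends by (simp add: D_def)
      with eb(2) same show ?thesis by (simp add: energy_def)
    qed
    then show ?thesis
      using y_nonneg[OF \<theta>] by (rule power2_le_imp_le)
  next
    case False
    with y_nonneg[OF \<theta>] show ?thesis by simp
  qed
  define f where "f \<theta> = fst (y \<theta>)" for \<theta>
  have cf: "continuous_on {0..D} f"
    unfolding f_def by (intro continuous_intros trajectory_on_continuous[OF tr_y])
  have df: "(f has_real_derivative snd (y \<theta>)) (at \<theta>)" if "0 < \<theta>" "\<theta> < D" for \<theta>
    unfolding f_def using trajectory_on_fst_derivative[OF tr_y, of \<theta>] that at_within_Icc_at[of 0 \<theta> D]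
    by simp
  have mono: "f \<theta> < f \<theta>'" if "0 \<le> \<theta>" "\<theta> < \<theta>'" "\<theta>' \<le> D" for \<theta> \<theta>'
  proof (rule DERIV_pos_imp_increasing_open[OF that(2)])
    fix r assume "\<theta> < r" "r < \<theta>'"
    then show "\<exists>y. (f has_real_derivative y) (at r) \<and> 0 < y"
      using df[of r] y_pos[of r] that by (intro exI[of _ "snd (y r)"]) (simp add: D_def)
  qed (use that in \<open>auto intro: continuous_on_subset[OF cf]\<close>)
  have mono_le: "f \<theta> \<le> f \<theta>'" if "0 \<le> \<theta>" "\<theta> \<le> \<theta>'" "\<theta>' \<le> D" for \<theta> \<theta>'
    using mono[of \<theta> \<theta>'] that by (cases "\<theta> = \<theta>'") auto
  have inj: "inj_on f {0..D}"
    by (rule linorder_inj_onI) (use mono in \<open>auto simp: less_le\<close>)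
  have f_ends: "f 0 = a" "f D = b"
    using y_ends by (simp_all add: f_def D_def)
  define \<Theta> where "\<Theta> = the_inv_into {0..D} f"
  have inv1: "\<Theta> (f \<theta>) = \<theta>" if "\<theta> \<in> {0..D}" for \<theta>
    unfolding \<Theta>_def by (rule the_inv_into_f_f[OF inj that])
  have img: "f ` {0..D} = {a..b}"
  proof
    show "f ` {0..D} \<subseteq> {a..b}"
    proof
      fix \<xi> assume "\<xi> \<in> f ` {0..D}"
      then obtain \<theta> where "\<theta> \<in> {0..D}" "\<xi> = f \<theta>" by blast
      with mono_le[of 0 \<theta>] mono_le[of \<theta> D] f_ends show "\<xi> \<in> {a..b}"
        by simp
    qed
    show "{a..b} \<subseteq> f ` {0..D}"
    proof
      fix \<xi> assume "\<xi> \<in> {a..b}"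
      then obtain \<theta> where "0 \<le> \<theta>" "\<theta> \<le> D" "f \<theta> = \<xi>"
        using IVT'[of f 0 \<xi> D] cf D f_ends by auto
      then show "\<xi> \<in> f ` {0..D}" by auto
    qed
  qed
  have c\<Theta>: "continuous_on {a..b} \<Theta>"
    using continuous_on_inv[OF cf compact_Icc, of \<Theta>] inv1 img by auto
  have inv2: "f (\<Theta> \<xi>) = \<xi>" "\<Theta> \<xi> \<in> {0..D}" if "\<xi> \<in> {a..b}" for \<xi>
    using inv1 that unfolding img[symmetric] by auto
  have inv3: "0 < \<Theta> \<xi>" "\<Theta> \<xi> < D" if "a < \<xi>" "\<xi> < b" for \<xi>
    using inv2[of \<xi>] that f_ends by (auto simp: less_le)
  have d\<Theta>: "(\<Theta> has_real_derivative inverse (snd (y (\<Theta> \<xi>)))) (at \<xi>)" if \<xi>: "a < \<xi>" "\<xi> < b" for \<xi>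
  proof (rule DERIV_inverse_function[where f = f and a = a and b = b])
    show "(f has_real_derivative snd (y (\<Theta> \<xi>))) (at (\<Theta> \<xi>))"
      by (rule df[OF inv3[OF \<xi>]])
    show "snd (y (\<Theta> \<xi>)) \<noteq> 0"
      using y_pos[of "\<Theta> \<xi>"] inv3[OF \<xi>] by (simp add: D_def)
    show "f (\<Theta> \<eta>) = \<eta>" if "a < \<eta>" "\<eta> < b" for \<eta>
      using inv2(1)[of \<eta>] that by simp
    show "isCont \<Theta> \<xi>"
      by (rule continuous_on_interior[OF c\<Theta>]) (use \<xi> in simp)
  qed (rule \<xi>)+
  define k where "k \<tau> = \<Theta> (fst (x \<tau>)) - \<tau>" for \<tau>
  have ck: "continuous_on {s..t} k"
    unfolding k_def
    by (intro continuous_intros continuous_on_compose2[OF c\<Theta>] fastest_continuous[OF x])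
      (use conf in auto)
  have dk: "\<exists>d. (k has_real_derivative d) (at \<tau>) \<and> d \<le> 0" if \<tau>: "s < \<tau>" "\<tau> < t" for \<tau>
  proof -
    have \<xi>: "a < fst (x \<tau>)" "fst (x \<tau>) < b" using ce2[OF \<tau>] by auto
    have dx: "((\<lambda>t. fst (x t)) has_real_derivative snd (x \<tau>)) (at \<tau>)"
      using fastest_fst_derivative[OF x, of \<tau>] \<tau> at_within_Icc_at[of s \<tau> t] by simp
    have "(k has_real_derivative inverse (snd (y (\<Theta> (fst (x \<tau>))))) * snd (x \<tau>) - 1) (at \<tau>)"
      unfolding k_def by (intro DERIV_diff DERIV_chain2[OF d\<Theta>[OF \<xi>] dx] DERIV_ident)
    moreover have "snd (x \<tau>) \<le> snd (y (\<Theta> (fst (x \<tau>))))"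
      using slower[of \<tau> "\<Theta> (fst (x \<tau>))"] \<tau> inv2[of "fst (x \<tau>)"] \<xi> by (simp add: f_def)
    moreover have "0 < snd (y (\<Theta> (fst (x \<tau>))))"
      using y_pos inv3[OF \<xi>] by (simp add: D_def)
    ultimately show ?thesis
      by (intro exI conjI) (assumption, simp add: divide_le_eq flip: divide_inverse_commute)
  qed
  have kmono: "k \<tau>' \<le> k \<tau>" if "s \<le> \<tau>" "\<tau> \<le> \<tau>'" "\<tau>' \<le> t" for \<tau> \<tau>'
    by (rule DERIV_nonpos_imp_decreasing_open[OF that(2)])
      (use dk that in \<open>auto intro: continuous_on_subset[OF ck]\<close>)
  have k_ends: "k s = - s" "k t = D - t"
    using ends inv1[of 0] inv1[of D] D f_ends by (simp_all add: k_def)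
  have Dst: "D = t - s"
    using kmono[of s t] k_ends st tD by simp
  have same: "fst (x \<tau>) = fst (y (\<tau> - s))" if \<tau>: "\<tau> \<in> {s..t}" for \<tau>
  proof -
    have "k \<tau> = - s"
      using kmono[of s \<tau>] kmono[of \<tau> t] k_ends \<tau> Dst by simp
    then have "\<Theta> (fst (x \<tau>)) = \<tau> - s" by (simp add: k_def)
    then show ?thesis
      using inv2(1)[of "fst (x \<tau>)"] conf[OF \<tau>] by (simp add: f_def)
  qed
  have ys: "trajectory_on s t (\<lambda>\<theta>. if \<theta> - s \<le> \<alpha> then - u1 else u2) (\<lambda>\<theta>. y (\<theta> - s))"
    using trajectory_on_shift[OF tr_y, of s] by (simp add: Dst)
  have xy: "x \<tau> = y (\<tau> - s)" if \<tau>: "\<tau> \<in> {s..t}" for \<tau>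
  proof -
    have "((\<lambda>t. fst (x t)) has_vector_derivative snd (x \<tau>)) (at \<tau> within cbox s t)"
      using fastest_fst_derivative[OF x \<tau>] by (simp add: has_real_derivative_iff_has_vector_derivative)
    moreover have "((\<lambda>t. fst (x t)) has_vector_derivative snd (y (\<tau> - s))) (at \<tau> within cbox s t)"
      using trajectory_on_fst_derivative[OF ys \<tau>]
      unfolding has_real_derivative_iff_has_vector_derivative cbox_interval
      by (rule has_vector_derivative_transform[where g = "\<lambda>t. fst (x t)", OF \<tau> same, rotated])
    ultimately have "snd (x \<tau>) = snd (y (\<tau> - s))"
      using vector_derivative_unique_within_closed_interval[of s t \<tau>] st \<tau> by auto
    with same[OF \<tau>] show ?thesis by (simp add: prod_eq_iff)
  qed
  show thesis
  proof (rule that[of "s + \<alpha>"])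
    show "s \<le> s + \<alpha>" "s + \<alpha> < t"
      using \<alpha>\<beta> Dst by (simp_all add: D_def)
    have "const_arc (- u1) s (s + \<alpha>) (\<lambda>t. y (t - s))"
      using trajectory_on_shift[OF yX, of s] by (simp add: add.commute)
    then show "const_arc (- u1) s (s + \<alpha>) x"
      by (rule trajectory_on_cong) (use xy \<alpha>\<beta> Dst in \<open>simp_all add: D_def\<close>)
    have "const_arc u2 (s + \<alpha>) t (\<lambda>t. y (t - s))"
      using trajectory_on_shift[OF yY, of s] Dst by (simp add: D_def algebra_simps)
    then show "const_arc u2 (s + \<alpha>) t x"
      by (rule trajectory_on_cong) (use xy \<alpha>\<beta> Dst in \<open>simp_all add: D_def\<close>)
    show "0 < snd (x \<tau>)" if "s < \<tau>" "\<tau> < t" for \<tau>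
      using xy[of \<tau>] y_pos[of "\<tau> - s"] that Dst by (simp add: D_def)
  qed
qed

lemma const_arc_time_reverse:
  assumes "const_arc v (- b) (- a) (time_reverse x)"
  shows "const_arc v a b x"
  using trajectory_on_time_reverse[OF assms] by simp

lemma fastest_confined_left:
  assumes x: "fastest s t x" and ends: "x s = (b, 0)" "x t = (a, 0)" "a < b"
    and conf: "\<And>\<tau>. \<tau> \<in> {s..t} \<Longrightarrow> a \<le> fst (x \<tau>) \<and> fst (x \<tau>) \<le> b"
  obtains \<sigma> where "s < \<sigma>" "\<sigma> \<le> t" "const_arc u2 s \<sigma> x" "const_arc (- u1) \<sigma> t x"
    "\<And>\<tau>. s < \<tau> \<Longrightarrow> \<tau> < t \<Longrightarrow> snd (x \<tau>) < 0"
proof -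
  have "time_reverse x (- t) = (a, 0)" "time_reverse x (- s) = (b, 0)"
    using ends by (simp_all add: time_reverse_def)
  then obtain \<sigma> where \<sigma>: "- t \<le> \<sigma>" "\<sigma> < - s" "const_arc (- u1) (- t) \<sigma> (time_reverse x)"
    "const_arc u2 \<sigma> (- s) (time_reverse x)"
    "\<And>\<tau>. - t < \<tau> \<Longrightarrow> \<tau> < - s \<Longrightarrow> 0 < snd (time_reverse x \<tau>)"
    using fastest_confined_right[OF fastest_time_reverse[OF x], of a b] ends(3) conf by auto
  show thesis
  proof (rule that[of "- \<sigma>"])
    show "const_arc u2 s (- \<sigma>) x"
      by (rule const_arc_time_reverse) (use \<sigma>(4) in simp)
    show "const_arc (- u1) (- \<sigma>) t x"
      by (rule const_arc_time_reverse) (use \<sigma>(3) in simp)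
    show "snd (x \<tau>) < 0" if "s < \<tau>" "\<tau> < t" for \<tau>
      using \<sigma>(5)[of "- \<tau>"] that by simp
  qed (use \<sigma> in auto)
qed

end

section \<open>Valleys and the finiteness of the rests\<close>

lemma rest_energy_eq:
  assumes "energy v (x s) = energy v (x t)" "snd (x s) = 0" "snd (x t) = 0"
    and "0 < fst (x s)" "0 < fst (x t)" "fst (x s) \<noteq> fst (x t)"
  shows "v * ((fst (x s))\<^sup>2 * (fst (x t))\<^sup>2) = 1"
proof -
  define p q where "p = (fst (x s))\<^sup>2" and "q = (fst (x t))\<^sup>2"
  have pq: "0 < p" "0 < q" "p \<noteq> q"
    using assms(4-6) by (simp_all add: p_def q_def power2_eq_iff)
  have "v * p + 1 / p = v * q + 1 / q"
    using assms(1-3) by (simp add: energy_def p_def q_def)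
  then have "(p - q) * (v * (p * q) - 1) = 0"
    using pq(1,2) by (simp add: field_simps)
  then show ?thesis
    using pq(3) by (simp add: p_def q_def)
qed

context bounded_control
begin

text \<open>An arc YX to the left followed by an arc XY to the right.  If no X-segment separated the
  Y-segments, a single Y-trajectory would return to its starting point.  Otherwise the junction
  condition \<open>cosh \<theta> + p * sinh \<theta> / k = 0\<close> holds with \<open>k = sqrt u1\<close>.  It forces the slope \<open>p\<close> below
  \<open>- k\<close>, and because of \<open>cosh \<theta> \<ge> 1\<close> it bounds the duration of the X-segment from below in terms of
  \<open>p\<close>.\<close>

lemma valley:
  assumes x: "fastest s t x"
    and arcs: "const_arc u2 s \<sigma> x" "const_arc (- u1) \<sigma> z x" "const_arc (- u1) z \<rho> x" "const_arc u2 \<rho> t x"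
    and times: "s < \<sigma>" "\<sigma> \<le> z" "z \<le> \<rho>" "\<rho> < t"
    and rest: "snd (x s) = 0" "snd (x z) = 0" "snd (x t) = 0"
    and low: "fst (x z) < fst (x s)" "fst (x z) < fst (x t)"
  shows "\<sigma> < \<rho>" "snd (x \<sigma>) / fst (x \<sigma>) < - sqrt u1"
    "1 \<le> \<bar>snd (x \<sigma>) / fst (x \<sigma>)\<bar> * gsin (- u1) (\<rho> - \<sigma>)"
proof -
  have pos: "0 < fst (x r)" if "r \<in> {s..t}" for r
    using fastest_pos[OF x that] .
  show "\<sigma> < \<rho>"
  proof (rule ccontr)
    assume "\<not> \<sigma> < \<rho>"
    then have eq: "\<sigma> = z" "\<rho> = z" using times by auto
    have Y: "const_arc u2 s t x"
      using const_arc_concat[OF arcs(1)[unfolded eq] arcs(4)[unfolded eq]] times eq by simp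
    have "u2 * ((fst (x z))\<^sup>2 * (fst (x s))\<^sup>2) = 1" "u2 * ((fst (x z))\<^sup>2 * (fst (x t))\<^sup>2) = 1"
      using times low pos
      by (auto intro!: rest_energy_eq const_arc_energy[OF Y] rest)
    then have "(fst (x z))\<^sup>2 * (fst (x s))\<^sup>2 = (fst (x z))\<^sup>2 * (fst (x t))\<^sup>2"
      using u2 by (metis mult_left_cancel not_one_le_zero)
    then have "(fst (x s))\<^sup>2 = (fst (x t))\<^sup>2"
      using pos[of z] times by simp
    then have "fst (x s) = fst (x t)"
      using pos[of s] pos[of t] times by (simp add: power2_eq_iff)
    then have "x s = x t"
      using rest by (simp add: prod_eq_iff)
    then show False
      using fastest_inj[OF x, of s t] times by auto
  qed
  define p k \<theta> where "p = snd (x \<sigma>) / fst (x \<sigma>)" and "k = sqrt u1" and "\<theta> = k * (\<rho> - \<sigma>)"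
  have k: "0 < k" using u1 by (simp add: k_def)
  have \<theta>: "0 < \<theta>" using k \<open>\<sigma> < \<rho>\<close> by (simp add: \<theta>_def)
  then have sh: "0 < sinh \<theta>" by simp
  have C: "gcos (- u1) (\<rho> - \<sigma>) = cosh \<theta>" and S: "gsin (- u1) (\<rho> - \<sigma>) = sinh \<theta> / k"
    using u1 by (simp_all add: gcos_def gsin_def \<theta>_def k_def)
  have "const_arc (- u1) \<sigma> \<rho> x"
    using const_arc_concat[OF arcs(2,3)] times by simp
  then have "gsin (- u1) (\<rho> - \<sigma>) = 0 \<or>
      gcos (- u1) (\<rho> - \<sigma>) + snd (x \<sigma>) / fst (x \<sigma>) * gsin (- u1) (\<rho> - \<sigma>) = 0"
    using fastest_junction[OF x times(1) \<open>\<sigma> < \<rho>\<close> times(4) arcs(1) _ arcs(4)] u1 u2 by auto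
  then have eq: "cosh \<theta> + p * (sinh \<theta> / k) = 0"
    using sh k unfolding C S p_def by simp
  have "sinh \<theta> < cosh \<theta>"
    using sinh_less_cosh_real by blast
  have "p = - k * cosh \<theta> / sinh \<theta>"
    using eq sh k by (simp add: field_simps)
  moreover have "k * sinh \<theta> < k * cosh \<theta>"
    using k \<open>sinh \<theta> < cosh \<theta>\<close> by simp
  then have "k < k * cosh \<theta> / sinh \<theta>"
    using sh by (simp only: pos_less_divide_eq)
  ultimately have "p < - k" by simp
  then show "snd (x \<sigma>) / fst (x \<sigma>) < - sqrt u1"
    by (simp add: p_def k_def)
  have "1 \<le> cosh \<theta>" by (rule cosh_real_ge_1)
  also have "cosh \<theta> = \<bar>p\<bar> * (sinh \<theta> / k)"
    using eq \<open>p < - k\<close> k by simp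
  finally show "1 \<le> \<bar>snd (x \<sigma>) / fst (x \<sigma>)\<bar> * gsin (- u1) (\<rho> - \<sigma>)"
    by (simp add: S p_def)
qed

lemma fastest_argmin:
  assumes "fastest a b x"
  obtains m where "m \<in> {a..b}" "\<And>t. t \<in> {a..b} \<Longrightarrow> fst (x m) \<le> fst (x t)"
proof -
  have "continuous_on {a..b} (\<lambda>t. fst (x t))"
    by (intro continuous_intros fastest_continuous[OF assms])
  from continuous_attains_inf[OF compact_Icc _ this] fastestD(1)[OF assms]
  show thesis using that by auto
qed

lemma fastest_argmax:
  assumes "fastest a b x"
  obtains m where "m \<in> {a..b}" "\<And>t. t \<in> {a..b} \<Longrightarrow> fst (x t) \<le> fst (x m)"
proof -
  have "continuous_on {a..b} (\<lambda>t. fst (x t))"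
    by (intro continuous_intros fastest_continuous[OF assms])
  from continuous_attains_sup[OF compact_Icc _ this] fastestD(1)[OF assms]
  show thesis using that by auto
qed

lemma fastest_extremum_at_rest:
  assumes x: "fastest a b x" and rest: "snd (x a) = 0" "snd (x b) = 0" and t: "t \<in> {a..b}"
    and ext: "(\<forall>s\<in>{a..b}. fst (x t) \<le> fst (x s)) \<or> (\<forall>s\<in>{a..b}. fst (x s) \<le> fst (x t))"
  shows "snd (x t) = 0"
  using fastest_interior_extremum[OF x _ _ ext] rest t by (cases "t = a \<or> t = b") auto

text \<open>If rests accumulated at \<open>t0\<close> from the right, then in an arbitrarily short window after \<open>t0\<close> the
  trajectory would contain a valley: take the rightmost point \<open>r0\<close> of the window, before it the
  leftmost point \<open>r1\<close>, and before that the rightmost point \<open>r2\<close>.  Between consecutive ones the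
  motion is an arc XY or YX, and the X-segment of the valley is too long for the window.\<close>

lemma fastest_zero_right_isolated:
  assumes x: "fastest s t x" and t0: "s \<le> t0" "t0 < t"
  shows "\<exists>h>0. \<forall>z. t0 < z \<and> z < t0 + h \<and> z \<le> t \<longrightarrow> snd (x z) \<noteq> 0"
proof (rule ccontr)
  assume "\<not> ?thesis"
  then have acc: "\<exists>z. t0 < z \<and> z < t0 + h \<and> z \<le> t \<and> snd (x z) = 0" if "0 < h" for h
    using that by blast
  have cx: "continuous_on {s..t} x" by (rule fastest_continuous[OF x])
  have pos: "fst (x r) \<noteq> 0" if "r \<in> {s..t}" for r
    using fastest_pos[OF x that] by simp
  have "continuous_on {s..t} (\<lambda>r. \<bar>snd (x r) / fst (x r)\<bar>)"
    by (intro continuous_intros cx) (use pos in auto)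
  from continuous_attains_sup[OF compact_Icc _ this] t0
  obtain P where P: "\<And>r. r \<in> {s..t} \<Longrightarrow> \<bar>snd (x r) / fst (x r)\<bar> \<le> P"
    by (metis (no_types, lifting) atLeastatMost_empty_iff order_trans less_imp_le)
  have P0: "0 \<le> P"
    by (rule order_trans[OF abs_ge_zero P[of s]]) (use t0 in simp)
  have "isCont (gsin (- u1)) 0"
    using gsin_derivative[of "- u1" 0 UNIV] u1 by (auto intro: DERIV_isCont)
  then have "\<exists>h>0. \<forall>r. dist r 0 < h \<longrightarrow> dist (gsin (- u1) r) (gsin (- u1) 0) < 1 / (P + 1)"
    unfolding continuous_at_eps_delta using P0 by simp
  then obtain h0 where h0: "0 < h0" "\<And>r. \<bar>r\<bar> < h0 \<Longrightarrow> \<bar>gsin (- u1) r\<bar> < 1 / (P + 1)"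
    by (auto simp: dist_real_def)
  obtain ze where ze: "t0 < ze" "ze < t0 + h0" "ze \<le> t" "snd (x ze) = 0"
    using acc[OF h0(1)] by blast
  have rest0: "snd (x t0) = 0"
  proof (rule ccontr)
    assume "snd (x t0) \<noteq> 0"
    moreover have "continuous_on {s..t} (\<lambda>r. snd (x r))"
      by (intro continuous_intros cx)
    ultimately obtain d where d: "0 < d"
      "\<And>r. r \<in> {s..t} \<Longrightarrow> dist r t0 < d \<Longrightarrow> dist (snd (x r)) (snd (x t0)) < \<bar>snd (x t0)\<bar>"
      unfolding continuous_on_iff using t0 by (metis atLeastAtMost_iff less_imp_le zero_less_abs_iff)
    from acc[OF d(1)] obtain r where "t0 < r" "r < t0 + d" "r \<le> t" "snd (x r) = 0" by blast
    with d(2)[of r] t0 show False by (simp add: dist_real_def)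
  qed
  have sub: "fastest a b x" if "t0 \<le> a" "a \<le> b" "b \<le> ze" for a b
    using fastest_subinterval[OF x] that t0 ze by auto
  have acc': "\<exists>z. t0 < z \<and> z < r \<and> snd (x z) = 0" if "t0 < r" for r
    using acc[of "r - t0"] that by auto
  obtain r0 where r0: "r0 \<in> {t0..ze}" "\<And>r. r \<in> {t0..ze} \<Longrightarrow> fst (x r) \<le> fst (x r0)"
    using fastest_argmax[OF sub[of t0 ze]] ze by auto
  have rest_r0: "snd (x r0) = 0"
    using fastest_extremum_at_rest[OF sub[of t0 ze] rest0 ze(4) r0(1)] r0(2) ze by auto
  have "t0 < r0"
  proof (rule ccontr)
    assume "\<not> t0 < r0"
    then have eq: "r0 = t0" using r0(1) by simp
    obtain m where m: "m \<in> {t0..ze}" "\<And>r. r \<in> {t0..ze} \<Longrightarrow> fst (x m) \<le> fst (x r)"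
      using fastest_argmin[OF sub[of t0 ze]] ze by auto
    have rest_m: "snd (x m) = 0"
      using fastest_extremum_at_rest[OF sub[of t0 ze] rest0 ze(4) m(1)] m(2) ze by auto
    have "fst (x ze) \<noteq> fst (x t0)"
      using fastest_inj[OF x, of ze t0] ze t0 rest0 by (auto simp: prod_eq_iff)
    then have less: "fst (x m) < fst (x t0)"
      using m(2)[of ze] r0(2)[of ze] eq ze by auto
    then have "t0 < m" using m(1) by (cases "m = t0") auto
    have "\<And>\<tau>. t0 < \<tau> \<Longrightarrow> \<tau> < m \<Longrightarrow> snd (x \<tau>) < 0"
    proof (rule fastest_confined_left[of t0 m x "fst (x t0)" "fst (x m)"])
      show "fastest t0 m x" using sub m(1) by auto
      show "fst (x m) \<le> fst (x \<tau>) \<and> fst (x \<tau>) \<le> fst (x t0)" if "\<tau> \<in> {t0..m}" for \<tau>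
        using m r0(2)[of \<tau>] eq that by auto
    qed (use rest0 rest_m less in \<open>auto simp: prod_eq_iff\<close>)
    with acc'[OF \<open>t0 < m\<close>] show False by force
  qed
  obtain r1 where r1: "r1 \<in> {t0..r0}" "\<And>r. r \<in> {t0..r0} \<Longrightarrow> fst (x r1) \<le> fst (x r)"
    using fastest_argmin[OF sub[of t0 r0]] r0 by auto
  have rest_r1: "snd (x r1) = 0"
    using fastest_extremum_at_rest[OF sub[of t0 r0] rest0 rest_r0 r1(1)] r1(2) r0(1) by auto
  have "fst (x t0) \<noteq> fst (x r0)"
    using fastest_inj[OF x, of t0 r0] ze t0 rest0 rest_r0 r0(1) \<open>t0 < r0\<close> by (auto simp: prod_eq_iff)
  then have less1: "fst (x r1) < fst (x r0)"
    using r1(2)[of t0] r0(2)[of t0] r0(1) by auto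
  obtain \<rho> where \<rho>: "r1 \<le> \<rho>" "\<rho> < r0" "const_arc (- u1) r1 \<rho> x" "const_arc u2 \<rho> r0 x"
    "\<And>\<tau>. r1 < \<tau> \<Longrightarrow> \<tau> < r0 \<Longrightarrow> 0 < snd (x \<tau>)"
  proof (rule fastest_confined_right[of r1 r0 x "fst (x r1)" "fst (x r0)"])
    show "fastest r1 r0 x" using sub r1(1) r0(1) by auto
    show "fst (x r1) \<le> fst (x \<tau>) \<and> fst (x \<tau>) \<le> fst (x r0)" if "\<tau> \<in> {r1..r0}" for \<tau>
      using r1 r0 that by auto
  qed (use rest_r0 rest_r1 less1 in \<open>auto simp: prod_eq_iff\<close>)
  have "t0 < r1"
    using \<rho>(5) acc'[OF \<open>t0 < r0\<close>] r1(1) by (cases "r1 = t0") force+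
  obtain r2 where r2: "r2 \<in> {t0..r1}" "\<And>r. r \<in> {t0..r1} \<Longrightarrow> fst (x r) \<le> fst (x r2)"
    using fastest_argmax[OF sub[of t0 r1]] r1(1) r0(1) by auto
  have rest_r2: "snd (x r2) = 0"
    using fastest_extremum_at_rest[OF sub[of t0 r1] rest0 rest_r1 r2(1)] r2(2) r1(1) r0(1) by auto
  have "fst (x t0) \<noteq> fst (x r1)"
    using fastest_inj[OF x, of t0 r1] ze t0 rest0 rest_r1 r0(1) r1(1) \<open>t0 < r1\<close> by (auto simp: prod_eq_iff)
  then have less2: "fst (x r1) < fst (x r2)"
    using r1(2)[of t0] r2(2)[of t0] r1(1) by auto
  obtain \<sigma> where \<sigma>: "r2 < \<sigma>" "\<sigma> \<le> r1" "const_arc u2 r2 \<sigma> x" "const_arc (- u1) \<sigma> r1 x"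
  proof (rule fastest_confined_left[of r2 r1 x "fst (x r2)" "fst (x r1)"])
    show "fastest r2 r1 x" using sub r2(1) r1(1) r0(1) by auto
    show "fst (x r1) \<le> fst (x \<tau>) \<and> fst (x \<tau>) \<le> fst (x r2)" if "\<tau> \<in> {r2..r1}" for \<tau>
      using r1 r2 that by auto
  qed (use rest_r1 rest_r2 less2 in \<open>auto simp: prod_eq_iff\<close>)
  have "fastest r2 r0 x" using sub r2(1) r1(1) r0(1) by auto
  note val = valley[OF this \<sigma>(3,4) \<rho>(3,4) \<sigma>(1,2) \<rho>(1,2) rest_r2 rest_r1 rest_r0 less2 less1]
  have "1 \<le> P * \<bar>gsin (- u1) (\<rho> - \<sigma>)\<bar>"
  proof -
    have "\<bar>snd (x \<sigma>) / fst (x \<sigma>)\<bar> * gsin (- u1) (\<rho> - \<sigma>)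
        \<le> \<bar>snd (x \<sigma>) / fst (x \<sigma>)\<bar> * \<bar>gsin (- u1) (\<rho> - \<sigma>)\<bar>"
      by (intro mult_left_mono) auto
    also have "\<dots> \<le> P * \<bar>gsin (- u1) (\<rho> - \<sigma>)\<bar>"
      using P[of \<sigma>] \<sigma> \<rho> r0(1) r1(1) r2(1) t0 ze by (intro mult_right_mono P) auto
    finally show ?thesis using val(3) by linarith
  qed
  moreover have "\<bar>gsin (- u1) (\<rho> - \<sigma>)\<bar> < 1 / (P + 1)"
    using \<sigma> \<rho> r0(1) r1(1) r2(1) ze by (intro h0(2)) auto
  then have "\<bar>gsin (- u1) (\<rho> - \<sigma>)\<bar> * (P + 1) < 1"
    using P0 by (simp add: less_divide_eq)
  ultimately show False
    by (simp add: algebra_simps)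
qed

lemma fastest_finite_zeros:
  assumes x: "fastest s t x"
  shows "finite {z \<in> {s..t}. snd (x z) = 0}"
proof -
  let ?Z = "{z \<in> {s..t}. snd (x z) = 0}"
  have "\<not> z islimpt ?Z" if z: "z \<in> {s..t}" for z
  proof
    assume lim: "z islimpt ?Z"
    have "\<exists>h>0. \<forall>r. z < r \<and> r < z + h \<and> r \<le> t \<longrightarrow> snd (x r) \<noteq> 0"
      using fastest_zero_right_isolated[OF x, of z] z
      by (cases "z = t") (auto intro!: exI[of _ 1])
    then obtain h where h: "0 < h" "\<And>r. z < r \<Longrightarrow> r < z + h \<Longrightarrow> r \<le> t \<Longrightarrow> snd (x r) \<noteq> 0"
      by blast
    have "\<exists>k>0. \<forall>r. - z < r \<and> r < - z + k \<and> r \<le> - s \<longrightarrow> snd (time_reverse x r) \<noteq> 0"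
      using fastest_zero_right_isolated[OF fastest_time_reverse[OF x], of "- z"] z
      by (cases "z = s") (auto intro!: exI[of _ 1])
    then obtain k where k: "0 < k"
      "\<And>r. - z < r \<Longrightarrow> r < - z + k \<Longrightarrow> r \<le> - s \<Longrightarrow> snd (time_reverse x r) \<noteq> 0"
      by blast
    obtain r where r: "r \<in> ?Z" "r \<noteq> z" "dist r z < min h k"
      using lim h(1) k(1) unfolding islimpt_approachable by (metis min_less_iff_conj)
    show False
    proof (cases "z < r")
      case True
      then show False using h(2)[of r] r by (auto simp: dist_real_def)
    next
      case False
      then show False using k(2)[of "- r"] r by (auto simp: dist_real_def)
    qed
  qed
  then have "finite ({s..t} \<inter> ?Z)"
    by (intro finite_not_islimpt_in_compact) auto
  then show ?thesis by (rule finite_subset[rotated]) auto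
qed

section \<open>Humps and dips\<close>

definition hump :: "real \<Rightarrow> real \<Rightarrow> (real \<Rightarrow> real \<times> real) \<Rightarrow> bool" where
  "hump s t x \<longleftrightarrow> s < t \<and> snd (x s) = 0 \<and> snd (x t) = 0 \<and> (\<forall>\<tau>\<in>{s<..<t}. 0 < snd (x \<tau>))"

definition dip :: "real \<Rightarrow> real \<Rightarrow> (real \<Rightarrow> real \<times> real) \<Rightarrow> bool" where
  "dip s t x \<longleftrightarrow> s < t \<and> snd (x s) = 0 \<and> snd (x t) = 0 \<and> (\<forall>\<tau>\<in>{s<..<t}. snd (x \<tau>) < 0)"

lemma dip_iff_hump_time_reverse: "dip s t x \<longleftrightarrow> hump (- t) (- s) (time_reverse x)"
proof -
  have "(\<forall>\<tau>\<in>{s<..<t}. snd (x \<tau>) < 0) \<longleftrightarrow> (\<forall>\<tau>\<in>{- t<..<- s}. 0 < snd (time_reverse x \<tau>))"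
    (is "?L \<longleftrightarrow> ?R")
  proof
    assume ?L
    then show ?R by (auto dest: bspec[of _ _ "- \<tau>" for \<tau>])
  next
    assume R: ?R
    show ?L
    proof
      fix \<tau> assume "\<tau> \<in> {s<..<t}"
      with R[rule_format, of "- \<tau>"] show "snd (x \<tau>) < 0" by simp
    qed
  qed
  then show ?thesis by (auto simp: dip_def hump_def)
qed

lemma fastest_strictly_right:
  assumes x: "fastest a b x" and right: "\<And>\<tau>. a < \<tau> \<Longrightarrow> \<tau> < b \<Longrightarrow> 0 < snd (x \<tau>)"
    and st: "a \<le> s" "s < t" "t \<le> b"
  shows "fst (x s) < fst (x t)"
proof (rule DERIV_pos_imp_increasing_open[OF st(2), where f = "\<lambda>r. fst (x r)"])
  show "continuous_on {s..t} (\<lambda>r. fst (x r))"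
    using st by (intro continuous_intros continuous_on_subset[OF fastest_continuous[OF x]]) auto
  fix r assume r: "s < r" "r < t"
  then have "((\<lambda>t. fst (x t)) has_real_derivative snd (x r)) (at r)"
    using fastest_fst_derivative[OF x, of r] st at_within_Icc_at[of a r b] by simp
  then show "\<exists>y. ((\<lambda>t. fst (x t)) has_real_derivative y) (at r) \<and> 0 < y"
    using right[of r] r st by auto
qed

lemma fastest_strictly_left:
  assumes x: "fastest a b x" and left: "\<And>\<tau>. a < \<tau> \<Longrightarrow> \<tau> < b \<Longrightarrow> snd (x \<tau>) < 0"
    and st: "a \<le> s" "s < t" "t \<le> b"
  shows "fst (x t) < fst (x s)"
  using fastest_strictly_right[OF fastest_time_reverse[OF x], of "- t" "- s"] left st by simp

lemma hump_arcs:
  assumes x: "fastest s t x" and h: "hump s t x"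
  obtains \<sigma> where "s \<le> \<sigma>" "\<sigma> < t" "const_arc (- u1) s \<sigma> x" "const_arc u2 \<sigma> t x"
proof (rule fastest_confined_right[OF x, of "fst (x s)" "fst (x t)"])
  have r: "fst (x \<tau>) < fst (x \<tau>')" if "s \<le> \<tau>" "\<tau> < \<tau>'" "\<tau>' \<le> t" for \<tau> \<tau>'
    using fastest_strictly_right[OF x _ that] h by (simp add: hump_def)
  show "fst (x s) < fst (x t)" using r h by (simp add: hump_def)
  show "fst (x s) \<le> fst (x \<tau>) \<and> fst (x \<tau>) \<le> fst (x t)" if "\<tau> \<in> {s..t}" for \<tau>
    using r[of s \<tau>] r[of \<tau> t] that by (cases "\<tau> = s"; cases "\<tau> = t") auto
qed (use h that in \<open>auto simp: hump_def prod_eq_iff\<close>)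

lemma dip_arcs:
  assumes x: "fastest s t x" and d: "dip s t x"
  obtains \<sigma> where "s < \<sigma>" "\<sigma> \<le> t" "const_arc u2 s \<sigma> x" "const_arc (- u1) \<sigma> t x"
proof (rule fastest_confined_left[OF x, of "fst (x s)" "fst (x t)"])
  have r: "fst (x \<tau>') < fst (x \<tau>)" if "s \<le> \<tau>" "\<tau> < \<tau>'" "\<tau>' \<le> t" for \<tau> \<tau>'
    using fastest_strictly_left[OF x _ that] d by (simp add: dip_def)
  show "fst (x t) < fst (x s)" using r d by (simp add: dip_def)
  show "fst (x t) \<le> fst (x \<tau>) \<and> fst (x \<tau>) \<le> fst (x s)" if "\<tau> \<in> {s..t}" for \<tau>
    using r[of s \<tau>] r[of \<tau> t] that by (cases "\<tau> = s"; cases "\<tau> = t") auto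
qed (use d that in \<open>auto simp: dip_def prod_eq_iff\<close>)

text \<open>Two humps in a row would together be a motion from the leftmost to the rightmost point with a rest
  in between, which is slower than the arc XY.\<close>

lemma no_consecutive_humps:
  assumes x: "fastest a b x" and ab: "a \<le> s" "t \<le> b" and h: "hump s z x" "hump z t x"
  shows False
proof -
  have st: "s < z" "z < t" using h by (auto simp: hump_def)
  have x': "fastest s t x" "fastest s z x" "fastest z t x"
    using fastest_subinterval[OF x] ab st by auto
  have r1: "fst (x \<tau>) < fst (x \<tau>')" if "s \<le> \<tau>" "\<tau> < \<tau>'" "\<tau>' \<le> z" for \<tau> \<tau>'
    using fastest_strictly_right[OF x'(2) _ that] h by (simp add: hump_def)
  have r2: "fst (x \<tau>) < fst (x \<tau>')" if "z \<le> \<tau>" "\<tau> < \<tau>'" "\<tau>' \<le> t" for \<tau> \<tau>'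
    using fastest_strictly_right[OF x'(3) _ that] h by (simp add: hump_def)
  have "\<And>\<tau>. s < \<tau> \<Longrightarrow> \<tau> < t \<Longrightarrow> 0 < snd (x \<tau>)"
  proof (rule fastest_confined_right[OF x'(1), of "fst (x s)" "fst (x t)"])
    show "fst (x s) < fst (x t)" using r1[of s z] r2[of z t] st by simp
    show "fst (x s) \<le> fst (x \<tau>) \<and> fst (x \<tau>) \<le> fst (x t)" if "\<tau> \<in> {s..t}" for \<tau>
    proof (cases "\<tau> \<le> z")
      case True
      then have "fst (x s) \<le> fst (x \<tau>)" "fst (x \<tau>) \<le> fst (x z)"
        using r1[of s \<tau>] r1[of \<tau> z] that by (cases "\<tau> = s"; cases "\<tau> = z"; force)+
      then show ?thesis using r2[of z t] st by simp
    next
      case False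
      then have "fst (x z) \<le> fst (x \<tau>)" "fst (x \<tau>) \<le> fst (x t)"
        using r2[of z \<tau>] r2[of \<tau> t] that by (cases "\<tau> = t"; force)+
      then show ?thesis using r1[of s z] st by simp
    qed
  qed (use h st in \<open>auto simp: hump_def prod_eq_iff\<close>)
  from this[OF st] h show False by (simp add: hump_def)
qed

lemma no_consecutive_dips:
  assumes x: "fastest a b x" and ab: "a \<le> s" "t \<le> b" and d: "dip s z x" "dip z t x"
  shows False
  using no_consecutive_humps[OF fastest_time_reverse[OF x], of "- t" "- s" "- z"] ab d
  by (simp add: dip_iff_hump_time_reverse)

lemma next_rest:
  assumes x: "fastest a t x" and s: "a \<le> s" "s < t" and rest: "snd (x s) = 0" "snd (x t) = 0"
  obtains z where "s < z" "z \<le> t" "hump s z x \<or> dip s z x"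
proof -
  define Z where "Z = {z \<in> {s<..t}. snd (x z) = 0}"
  have "finite Z"
    by (rule finite_subset[OF _ fastest_finite_zeros[OF x]]) (use s in \<open>auto simp: Z_def\<close>)
  moreover have "t \<in> Z" using s rest by (simp add: Z_def)
  ultimately have z: "Min Z \<in> Z" "\<And>r. r \<in> Z \<Longrightarrow> Min Z \<le> r"
    by (auto intro: Min_in)
  define z where "z = Min Z"
  have sz: "s < z" "z \<le> t" "snd (x z) = 0"
    using z(1) by (auto simp: Z_def z_def)
  have nz: "snd (x r) \<noteq> 0" if "s < r" "r < z" for r
    using z(2)[of r] that sz(2) by (force simp: Z_def z_def)
  have cont: "continuous_on A (\<lambda>r. snd (x r))" if "A \<subseteq> {a..t}" for A
    using that by (intro continuous_intros continuous_on_subset[OF fastest_continuous[OF x]]) auto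
  define m where "m = (s + z) / 2"
  have m: "s < m" "m < z" using sz by (auto simp: m_def)
  have same_sign: "0 < snd (x m) * snd (x r)" if r: "s < r" "r < z" for r
  proof (rule ccontr)
    assume neg: "\<not> 0 < snd (x m) * snd (x r)"
    define l u where "l = min m r" and "u = max m r"
    have lu: "s < l" "l \<le> u" "u < z" using m r by (auto simp: l_def u_def)
    have "snd (x l) * snd (x u) \<le> 0"
      using neg by (auto simp: l_def u_def min_def max_def mult.commute)
    then have "(snd (x l) \<le> 0 \<and> 0 \<le> snd (x u)) \<or> (snd (x u) \<le> 0 \<and> 0 \<le> snd (x l))"
      by (auto simp: mult_le_0_iff)
    then obtain w where "l \<le> w" "w \<le> u" "snd (x w) = 0"
    proof
      assume "snd (x l) \<le> 0 \<and> 0 \<le> snd (x u)"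
      then show thesis
        using IVT'[of "\<lambda>r. snd (x r)" l 0 u] that lu cont[of "{l..u}"] s sz by auto
    next
      assume "snd (x u) \<le> 0 \<and> 0 \<le> snd (x l)"
      then show thesis
        using IVT2'[of "\<lambda>r. snd (x r)" u 0 l] that lu cont[of "{l..u}"] s sz by auto
    qed
    with nz[of w] lu show False by auto
  qed
  have "hump s z x \<or> dip s z x"
  proof (cases "0 < snd (x m)")
    case True
    then have "0 < snd (x r)" if "s < r" "r < z" for r
      using same_sign[OF that] by (simp add: zero_less_mult_iff)
    then show ?thesis using sz rest by (simp add: hump_def)
  next
    case False
    then have "snd (x r) < 0" if "s < r" "r < z" for r
      using same_sign[OF that] by (auto simp: zero_less_mult_iff)
    then show ?thesis using sz rest by (simp add: dip_def)
  qed
  with sz that show thesis by blast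
qed

text \<open>The two rest points of a Y-trajectory have \<open>x1\<close>-coordinates with product \<open>1 / sqrt u2 \<le> 1\<close>.\<close>

lemma no_Y_arc_between_outer_rests:
  assumes Y: "const_arc u2 s t x" and st: "s < t" and rest: "snd (x s) = 0" "snd (x t) = 0"
    and outer: "1 \<le> fst (x s)" "1 \<le> fst (x t)" "fst (x s) \<noteq> fst (x t)"
  shows False
proof -
  have "u2 * ((fst (x s))\<^sup>2 * (fst (x t))\<^sup>2) = 1"
    using outer st by (intro rest_energy_eq const_arc_energy[OF Y] rest) auto
  moreover have "1 < (fst (x s))\<^sup>2 * (fst (x t))\<^sup>2"
  proof -
    have "1 < fst (x s) * fst (x t)"
    proof (cases "1 < fst (x s)")
      case True
      then show ?thesis using outer(2) less_1_mult'[of "fst (x s)" "fst (x t)"] by simp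
    next
      case False
      then show ?thesis using outer by auto
    qed
    then show ?thesis by (simp add: power_mult_distrib[symmetric])
  qed
  moreover have "1 * ((fst (x s))\<^sup>2 * (fst (x t))\<^sup>2) \<le> u2 * ((fst (x s))\<^sup>2 * (fst (x t))\<^sup>2)"
    using u2 by (intro mult_right_mono) auto
  ultimately show False by simp
qed

lemma hump_from_outer_rest:
  assumes x: "fastest s z x" and h: "hump s z x" and outer: "1 \<le> fst (x s)"
    and \<sigma>: "s \<le> \<sigma>" "\<sigma> < z" "const_arc u2 \<sigma> z x"
  shows "s < \<sigma>"
proof (rule ccontr)
  assume "\<not> s < \<sigma>"
  with \<sigma> have "const_arc u2 s z x" by simp
  moreover have "fst (x s) < fst (x z)"
    using fastest_strictly_right[OF x, of s z] h by (simp add: hump_def)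
  ultimately show False
    using no_Y_arc_between_outer_rests[of s z x] h outer by (simp add: hump_def)
qed

text \<open>Suppose that a dip follows.  The hump ends and the dip begins with a Y-segment from the slope \<open>m\<close>
  at \<open>\<sigma>1\<close> to the switching time \<open>\<sigma>2\<close>, and \<open>m < sqrt u1\<close> by conservation of energy.  After the dip
  there is either a valley, whose X-segment needs a slope below \<open>- sqrt u1\<close> at \<open>\<sigma>2\<close> although the
  quarter turn leads to \<open>- m\<close>; or the end of the trajectory, so that \<open>x1 > 1\<close> at both \<open>\<sigma>1\<close> and
  \<open>\<sigma>2\<close> although the quarter turn makes \<open>1 / (x1 \<sigma>1 * x1 \<sigma>2)\<^sup>2\<close> equal to \<open>m\<^sup>2 + u2\<close>.\<close>

lemma hump_from_outer_rest_is_final: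
  assumes x: "fastest s t x" and rest: "snd (x s) = 0" "snd (x t) = 0"
    and outer: "1 \<le> fst (x s)" "1 \<le> fst (x t)"
    and h: "hump s z1 x" and zt: "z1 \<le> t"
  shows "z1 = t"
proof (rule ccontr)
  assume "z1 \<noteq> t"
  with zt have z1: "s < z1" "z1 < t" using h by (auto simp: hump_def)
  note sub = fastest_subinterval[OF x]
  obtain \<sigma>1 where \<sigma>1: "s \<le> \<sigma>1" "\<sigma>1 < z1" "const_arc (- u1) s \<sigma>1 x" "const_arc u2 \<sigma>1 z1 x"
    using hump_arcs[OF sub[of s z1] h] z1 by auto
  have s\<sigma>1: "s < \<sigma>1"
    using hump_from_outer_rest[OF sub[of s z1] h outer(1) \<sigma>1(1,2,4)] z1 by simp
  have pos: "0 < fst (x r)" if "r \<in> {s..t}" for r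
    using fastest_pos[OF x that] .
  define m where "m = snd (x \<sigma>1) / fst (x \<sigma>1)"
  have out1: "1 < fst (x \<sigma>1)"
    using fastest_strictly_right[OF sub[of s z1], of s \<sigma>1] h s\<sigma>1 \<sigma>1(2) z1 outer(1) by (simp add: hump_def)
  have m: "m\<^sup>2 < u1"
  proof -
    define r a where "r = (fst (x \<sigma>1))\<^sup>2" and "a = (fst (x s))\<^sup>2"
    have r: "0 < r" and a: "1 \<le> a" using out1 outer(1) by (simp_all add: r_def a_def)
    have "energy (- u1) (x \<sigma>1) = energy (- u1) (x s)"
      using s\<sigma>1 by (intro const_arc_energy[OF \<sigma>1(3)]) auto
    \<comment> \<open>The bracket is the energy of the initial rest, which is at most \<open>0\<close>.\<close>
    then have "(snd (x \<sigma>1))\<^sup>2 = u1 * r - 1 / r + (1 / a - u1 * a)"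
      using rest(1) by (simp add: energy_def r_def a_def)
    moreover have "1 / a \<le> 1" using a by simp
    moreover have "1 * 1 \<le> u1 * a" using a u1 by (intro mult_mono) auto
    moreover have "0 < 1 / r" using r by simp
    ultimately have "(snd (x \<sigma>1))\<^sup>2 < u1 * r" by linarith
    then show ?thesis
      using r by (simp add: m_def power_divide r_def divide_less_eq)
  qed
  obtain z2 where z2: "z1 < z2" "z2 \<le> t" "hump z1 z2 x \<or> dip z1 z2 x"
    using next_rest[OF x, of z1] z1 h rest by (auto simp: hump_def)
  then have d: "dip z1 z2 x"
    using no_consecutive_humps[OF x _ _ h, of z2] by auto
  obtain \<sigma>2 where \<sigma>2: "z1 < \<sigma>2" "\<sigma>2 \<le> z2" "const_arc u2 z1 \<sigma>2 x" "const_arc (- u1) \<sigma>2 z2 x"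
    using dip_arcs[OF sub[of z1 z2] d] z1 z2 by auto
  have Y: "const_arc u2 \<sigma>1 \<sigma>2 x"
    using const_arc_concat[OF \<sigma>1(4) \<sigma>2(3)] \<sigma>1 \<sigma>2 by simp
  have quarter: "gcos u2 (\<sigma>2 - \<sigma>1) + snd (x \<sigma>1) / fst (x \<sigma>1) * gsin u2 (\<sigma>2 - \<sigma>1) = 0" if "\<sigma>2 < z2"
  proof (rule ccontr)
    assume "\<not> ?thesis"
    moreover have "gsin u2 (\<sigma>2 - \<sigma>1) = 0 \<or>
        gcos u2 (\<sigma>2 - \<sigma>1) + snd (x \<sigma>1) / fst (x \<sigma>1) * gsin u2 (\<sigma>2 - \<sigma>1) = 0"
      using that s\<sigma>1 \<sigma>1(2) \<sigma>2(1) z2 z1 u1 u2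
      by (intro fastest_junction[OF sub[of s z2] _ _ _ \<sigma>1(3) Y \<sigma>2(4)]) auto
    ultimately have S: "gsin u2 (\<sigma>2 - \<sigma>1) = 0" by blast
    have u2': "u2 \<noteq> 0" using u2 by simp
    have "gcos u2 (\<sigma>2 - \<sigma>1) \<noteq> 0"
      using gcos_gsin_pythagoras[OF u2', of "\<sigma>2 - \<sigma>1"] S by auto
    then have "half_plane (x \<sigma>2) = half_plane (x \<sigma>1)"
      using const_arc_eq_riccati_flow[OF Y u2', of \<sigma>2] \<sigma>1(2) \<sigma>2(1) S by (simp add: riccati_flow_def)
    then have "x \<sigma>2 = x \<sigma>1"
      using pos s\<sigma>1 \<sigma>1(2) \<sigma>2 z2 by (intro half_plane_inj) auto
    then show False
      using fastest_inj[OF x, of \<sigma>2 \<sigma>1] s\<sigma>1 \<sigma>1(2) \<sigma>2 z2 by auto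
  qed
  note turn = riccati_flow_quarter_turn[OF Y _ _ quarter]
  show False
  proof (cases "z2 = t")
    case True
    have left: "fst (x b) < fst (x a)" if "z1 \<le> a" "a < b" "b \<le> z2" for a b
      using fastest_strictly_left[OF sub[of z1 z2] _ that] d z1 z2 by (simp add: dip_def)
    have \<sigma>2z: "\<sigma>2 < z2"
    proof (rule ccontr)
      assume "\<not> \<sigma>2 < z2"
      with \<sigma>2 have "const_arc u2 z1 z2 x" by simp
      then show False
        using no_Y_arc_between_outer_rests[of z1 z2 x] z2(1) d outer(2) left[of z1 z2] True
        by (simp add: dip_def)
    qed
    have "1 / ((fst (x \<sigma>1))\<^sup>2 * (fst (x \<sigma>2))\<^sup>2) = m\<^sup>2 + u2"
      using turn(2)[OF _ _ \<sigma>2z] u2 \<sigma>1(2) \<sigma>2(1) by (simp add: m_def)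
    moreover have "1 < fst (x \<sigma>2)"
      using left[of \<sigma>2 z2] \<sigma>2 \<sigma>2z True outer(2) by simp
    then have "1 < (fst (x \<sigma>1))\<^sup>2 * (fst (x \<sigma>2))\<^sup>2"
      using out1 by (simp add: less_1_mult power_mult_distrib[symmetric])
    then have "1 / ((fst (x \<sigma>1))\<^sup>2 * (fst (x \<sigma>2))\<^sup>2) < 1"
      by (simp add: divide_less_eq)
    moreover have "1 \<le> m\<^sup>2 + u2" using u2 zero_le_power2[of m] by linarith
    ultimately show False by simp
  next
    case False
    with z2 have z2t: "z2 < t" by simp
    obtain z3 where z3: "z2 < z3" "z3 \<le> t" "hump z2 z3 x \<or> dip z2 z3 x"
      using next_rest[OF x _ z2t] z1 z2 d rest by (auto simp: dip_def)
    then have h3: "hump z2 z3 x"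
      using no_consecutive_dips[OF x _ _ d, of z3] z1 by auto
    obtain \<sigma>3 where \<sigma>3: "z2 \<le> \<sigma>3" "\<sigma>3 < z3" "const_arc (- u1) z2 \<sigma>3 x" "const_arc u2 \<sigma>3 z3 x"
      using hump_arcs[OF sub[of z2 z3] h3] z1 z2 z3 by auto
    have "fst (x z2) < fst (x z1)" "fst (x z2) < fst (x z3)"
      using fastest_strictly_left[OF sub[of z1 z2], of z1 z2] d
        fastest_strictly_right[OF sub[of z2 z3], of z2 z3] h3 z1 z2 z3
      by (simp_all add: dip_def hump_def)
    then have steep: "snd (x \<sigma>2) / fst (x \<sigma>2) < - sqrt u1"
      using sub[of z1 z3] z1 z2 z3 d h3
      by (intro valley(2)[of z1 z3 x \<sigma>2 z2 \<sigma>3] \<sigma>2 \<sigma>3) (simp_all add: dip_def hump_def)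
    have "\<sigma>2 \<noteq> z2"
      using steep d u1 by (auto simp: dip_def)
    then have "snd (x \<sigma>2) / fst (x \<sigma>2) = - m"
      using turn(1) \<sigma>2 u2 \<sigma>1(2) by (simp add: m_def)
    with steep have "sqrt u1 < m" by simp
    then have "(sqrt u1)\<^sup>2 < m\<^sup>2"
      using u1 by (intro power_strict_mono) auto
    with m u1 show False by simp
  qed
qed

section \<open>Assembling the switching word\<close>

text \<open>A recursive form of \<open>has_form\<close> on an arbitrary time interval, suited to adding segments at the
  front.\<close>

fun segments :: "real \<Rightarrow> real \<Rightarrow> (real \<Rightarrow> real \<times> real) \<Rightarrow> segment_kind list \<Rightarrow> bool" where
  "segments a b x [] \<longleftrightarrow> a = b"
| "segments a b x (k # w) \<longleftrightarrow> (\<exists>c>a. const_arc (control_value u1 u2 k) a c x \<and> segments c b x w)"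

lemma segments_imp_switching_times:
  "segments a b x w \<Longrightarrow> \<exists>\<tau> :: nat \<Rightarrow> real. \<tau> 0 = a \<and> \<tau> (length w) = b \<and>
    (\<forall>i<length w. \<tau> i < \<tau> (Suc i) \<and> const_arc (control_value u1 u2 (w ! i)) (\<tau> i) (\<tau> (Suc i)) x)"
proof (induction w arbitrary: a)
  case Nil
  then show ?case by (intro exI[of _ "\<lambda>_. a"]) simp
next
  case (Cons k w)
  then obtain c where c: "a < c" "const_arc (control_value u1 u2 k) a c x" "segments c b x w"
    by auto
  from Cons.IH[OF c(3)] obtain \<tau> where \<tau>: "\<tau> 0 = c" "\<tau> (length w) = b"
    "\<And>i. i < length w \<Longrightarrow> \<tau> i < \<tau> (Suc i) \<and> const_arc (control_value u1 u2 (w ! i)) (\<tau> i) (\<tau> (Suc i)) x"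
    by blast
  show ?case
  proof (intro exI[of _ "case_nat a \<tau>"] conjI allI impI)
    fix i assume "i < length (k # w)"
    then show "case_nat a \<tau> i < case_nat a \<tau> (Suc i)"
      "const_arc (control_value u1 u2 ((k # w) ! i)) (case_nat a \<tau> i) (case_nat a \<tau> (Suc i)) x"
      using c \<tau>(1) \<tau>(3) by (cases i; simp)+
  qed (use \<tau>(2) in simp_all)
qed

lemma segments_imp_has_form: "segments 0 T x w \<Longrightarrow> has_form u1 u2 T x w"
  unfolding has_form_def by (rule segments_imp_switching_times)

lemma segments_extend_first:
  assumes "segments b c x (k # w)" "const_arc (control_value u1 u2 k) a b x" "a \<le> b"
  shows "segments a c x (k # w)"
proof -
  obtain e where e: "b < e" "const_arc (control_value u1 u2 k) b e x" "segments e c x w"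
    using assms(1) by auto
  have "const_arc (control_value u1 u2 k) a e x"
    using const_arc_concat[OF assms(2) e(2) assms(3)] e(1) by simp
  then show ?thesis
    unfolding segments.simps using e assms(3) by (intro exI[of _ e]) auto
qed

text \<open>Each valley contributes a block YXY, and the Y-segments of adjacent blocks merge at the rest between
  them.  The induction on the number of remaining rests peels off the first valley.\<close>

lemma spiral_segments:
  assumes "fastest s t x" "snd (x s) = 0" "snd (x t) = 0"
    and "dip s z x" "z \<le> t" and "\<And>r. s \<le> r \<Longrightarrow> \<not> dip r t x"
  shows "\<exists>n\<ge>1. segments s t x (spiral_word n)"
  using assms
proof (induction "card {z \<in> {s..t}. snd (x z) = 0}" arbitrary: s z rule: less_induct)
  case less
  note x = less.prems(1) and rest = less.prems(2,3) and d = less.prems(4) and last = less.prems(6)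
  note sub = fastest_subinterval[OF x]
  have sz: "s < z" using d by (simp add: dip_def)
  have zt: "z < t"
    using less.prems(5) last[of s] d by (cases "z = t") auto
  obtain z2 where z2: "z < z2" "z2 \<le> t" "hump z z2 x \<or> dip z z2 x"
    using next_rest[OF x, of z] sz zt d rest by (auto simp: dip_def)
  then have h: "hump z z2 x"
    using no_consecutive_dips[OF x _ _ d, of z2] by auto
  obtain \<sigma> where \<sigma>: "s < \<sigma>" "\<sigma> \<le> z" "const_arc u2 s \<sigma> x" "const_arc (- u1) \<sigma> z x"
    using dip_arcs[OF sub[of s z] d] sz zt by auto
  obtain \<rho> where \<rho>: "z \<le> \<rho>" "\<rho> < z2" "const_arc (- u1) z \<rho> x" "const_arc u2 \<rho> z2 x"
    using hump_arcs[OF sub[of z z2] h] sz z2 by auto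
  have "fst (x z) < fst (x s)" "fst (x z) < fst (x z2)"
    using fastest_strictly_left[OF sub[of s z], of s z] d
      fastest_strictly_right[OF sub[of z z2], of z z2] h sz z2
    by (simp_all add: dip_def hump_def)
  then have \<sigma>\<rho>: "\<sigma> < \<rho>"
    using sub[of s z2] sz z2 d h
    by (intro valley(1)[of s z2 x \<sigma> z \<rho>] \<sigma> \<rho>) (simp_all add: dip_def hump_def)
  have X: "const_arc (- u1) \<sigma> \<rho> x"
    using const_arc_concat[OF \<sigma>(4) \<rho>(3)] \<sigma> \<rho> by simp
  have extend: "segments s t x (Yseg # Xseg # Yseg # w)" if "segments \<rho> t x (Yseg # w)" for w
    using that \<sigma>(1,3) X \<sigma>\<rho> by auto
  show ?case
  proof (cases "z2 = t")
    case True
    have "segments \<rho> t x [Yseg]" using \<rho> True by auto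
    from extend[OF this] show ?thesis
      by (intro exI[of _ 1]) (simp add: spiral_word_def)
  next
    case False
    with z2 have z2t: "z2 < t" by simp
    obtain z3 where z3: "z2 < z3" "z3 \<le> t" "hump z2 z3 x \<or> dip z2 z3 x"
      using next_rest[OF x _ z2t] sz z2 h rest by (auto simp: hump_def)
    then have d3: "dip z2 z3 x"
      using no_consecutive_humps[OF x _ _ h, of z3] sz by auto
    have "{z \<in> {z2..t}. snd (x z) = 0} \<subset> {z \<in> {s..t}. snd (x z) = 0}"
      using sz z2 zt rest by (auto simp: psubset_eq set_eq_iff intro!: exI[of _ s])
    then have "card {z \<in> {z2..t}. snd (x z) = 0} < card {z \<in> {s..t}. snd (x z) = 0}"
      by (intro psubset_card_mono fastest_finite_zeros[OF x])
    moreover have "fastest z2 t x" using sub[of z2 t] sz z2 by simp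
    moreover have "\<not> dip r t x" if "z2 \<le> r" for r
      using last[of r] that sz z2 by simp
    ultimately obtain n where n: "1 \<le> n" "segments z2 t x (spiral_word n)"
      using less.hyps[of z2 z3] h rest d3 z3 by (auto simp: hump_def)
    define w where "w = concat (replicate n [Xseg, Yseg])"
    have "segments \<rho> t x (Yseg # w)"
      using segments_extend_first[of z2 t x Yseg w \<rho>] n(2) \<rho> by (simp add: spiral_word_def w_def)
    from extend[OF this] show ?thesis
      by (intro exI[of _ "Suc n"]) (simp add: spiral_word_def w_def)
  qed
qed

lemma optimal_imp_fastest:
  assumes "optimal_trajectory u1 u2 \<gamma> T x"
  shows "fastest 0 T x" "x 0 = (1, 0)" "x T = (\<gamma>, 0)"
proof -
  obtain u where u: "transfer u1 u2 \<gamma> T u x"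
    and opt: "\<And>T' u' x'. transfer u1 u2 \<gamma> T' u' x' \<Longrightarrow> T \<le> T'"
    using assms unfolding optimal_trajectory_def by blast
  show ends: "x 0 = (1, 0)" "x T = (\<gamma>, 0)"
    using u by (simp_all add: transfer_def)
  have "T \<le> S" if reach: "reach S (1, 0) (\<gamma>, 0)" for S
  proof -
    obtain y v where y: "0 \<le> S" "y 0 = (1, 0)" "y S = (\<gamma>, 0)"
      and v: "\<forall>t\<in>{0..S}. v t \<in> {- u1..u2}" "trajectory_on 0 S v y"
      using reach unfolding reach_def admissible_arc_def by blast
    have "transfer u1 u2 \<gamma> S v y"
      using y v trajectory_on_measurable_control[OF v(2) y(1)]
      by (simp add: transfer_def admissible_control_def)
    then show ?thesis by (rule opt)
  qed
  moreover have "admissible_arc 0 T x"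
    using u unfolding transfer_def admissible_control_def admissible_arc_def by blast
  ultimately show "fastest 0 T x"
    using u ends by (simp add: fastest_def transfer_def)
qed

end

text \<open>The final piece is a hump because the reversed trajectory starts at rest in \<open>\<gamma>\<close> and ends at rest in
  \<open>1\<close>: a final dip would be an initial hump there, hence the whole trajectory, and would lead from
  \<open>1\<close> to the left although \<open>\<gamma> > 1\<close>.\<close>

theorem proposition4:
  fixes u1 u2 \<gamma> T :: real and x :: "real \<Rightarrow> real \<times> real"
  assumes "u1 \<ge> 1" and "u2 \<ge> 1" and "\<gamma> > 1"
    and "optimal_trajectory u1 u2 \<gamma> T x"
  shows "has_form u1 u2 T x [Xseg, Yseg] \<or>
         (\<exists>n\<ge>1. has_form u1 u2 T x (spiral_word n))"
proof -
  interpret bounded_control u1 u2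
    by unfold_locales fact+
  note opt = optimal_imp_fastest[OF assms(4)]
  have rest: "snd (x 0) = 0" "snd (x T) = 0" and T: "0 < T"
    using opt fastestD(1)[OF opt(1)] assms(3) by (auto simp: less_le)
  obtain z where z: "0 < z" "z \<le> T" "hump 0 z x \<or> dip 0 z x"
    using next_rest[OF opt(1) _ T rest] by auto
  from z(3) show ?thesis
  proof
    assume h: "hump 0 z x"
    then have "z = T"
      using hump_from_outer_rest_is_final[OF opt(1) rest _ _ h z(2)] opt assms(3) by simp
    with h have h: "hump 0 T x" by simp
    obtain \<sigma> where \<sigma>: "0 \<le> \<sigma>" "\<sigma> < T" "const_arc (- u1) 0 \<sigma> x" "const_arc u2 \<sigma> T x"
      by (rule hump_arcs[OF opt(1) h])
    have "0 < \<sigma>"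
      using hump_from_outer_rest[OF opt(1) h _ \<sigma>(1,2,4)] opt(2) by simp
    with \<sigma> have "segments 0 T x [Xseg, Yseg]" by auto
    then show ?thesis
      by (intro disjI1 segments_imp_has_form)
  next
    assume d: "dip 0 z x"
    have "\<not> dip r T x" if r: "0 \<le> r" for r
    proof
      assume dr: "dip r T x"
      let ?y = "time_reverse x"
      have y: "fastest (- T) 0 ?y"
        using fastest_time_reverse[OF opt(1)] by simp
      have hr: "hump (- T) (- r) ?y"
        using dr by (simp add: dip_iff_hump_time_reverse)
      have "- r = 0"
        using hump_from_outer_rest_is_final[OF y _ _ _ _ hr] opt(2,3) assms(3) r by simp
      then have "fst (x T) < fst (x 0)"
        using fastest_strictly_left[OF opt(1), of 0 T] dr T by (simp add: dip_def)
      with opt(2,3) assms(3) show False by simp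
    qed
    from spiral_segments[OF opt(1) rest d z(2) this]
    show ?thesis using segments_imp_has_form by blast
  qed
qed

end
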